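(* There exist $C \in \mathbb{R}_{>0}$ and $\rho \in (0,1)$ such that $$\|\mu_r(\text{Rédei}) - \pi_{\text{C.L.}}\|_1 \leq C \cdot \rho^r$$ holds for every $r \in \mathbb{Z}_{\geq 0}$.
   Context: For integers $0 \leq \kappa \leq r$, let $X_r(\text{Rédei}, \kappa)$ be the random variable given by the corank (dimension of the kernel) of an $r \times r$ matrix $A$ chosen uniformly at random among all $r\times r$ matrices with coefficients in $\mathbb{F}_2$ satisfying $$A(i,h) = A(h,i) + 1 \text{ for all } 1 \leq i < h \leq \kappa, \qquad A(i,h) = A(h,i) \text{ for all } \kappa < h \leq r \text{ and } 1 \leq i \leq r.$$ For an integer $r \geq 0$, $\mu_r(\text{Rédei})$ denotes the probability distribution on $\mathbb{Z}_{\geq 0}$ given by $$\mu_r(\text{Rédei})(j) = \frac{1}{2^r} \sum_{\kappa=0}^r \binom{r}{\kappa}\, \mathbb{P}(X_r(\text{Rédei},\kappa) = j).$$ For $k \in \mathbb{Z}_{\geq 0} \cup \{\infty\}$ put $\eta_k(t) := \prod_{j=1}^k (1 - t^{-j})$. The probability distribution $\pi_{\text{C.L.}}$ on $\mathbb{Z}_{\geq 0}$ is given by $$\pi_{\text{C.L.}}(j) = 2^{-j^2}\, \eta_\infty(2)\, \eta_j(2)^{-2}.$$ For $f : \mathbb{Z}_{\geq 0} \to \mathbb{R}$, $\|f\|_1 = \sum_{j \geq 0} |f(j)|$. *)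

theory Defs
  imports
    "HOL-Library.Z2"
    "HOL-Library.Extended_Nat"
    "HOL-Analysis.Analysis"
    "HOL-Probability.Probability_Mass_Function"
    "Jordan_Normal_Form.Matrix_Kernel"
begin

text \<open>
  The type \<^typ>\<open>bit\<close> is the field with two elements. Row and column indices of
  \<^typ>\<open>bit mat\<close> start at 0, so the conditions for \<open>1 \<le> i < h \<le> \<kappa>\<close> and for
  \<open>\<kappa> < h \<le> r\<close>, \<open>1 \<le> i \<le> r\<close> become the ones below.
\<close>

definition redei_matrices :: "nat \<Rightarrow> nat \<Rightarrow> bit mat set" where
  "redei_matrices r \<kappa> = {A \<in> carrier_mat r r.
     (\<forall>i h. i < h \<and> h < \<kappa> \<longrightarrow> A $$ (i, h) = A $$ (h, i) + 1) \<and>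
     (\<forall>i h. \<kappa> \<le> h \<and> h < r \<and> i < r \<longrightarrow> A $$ (i, h) = A $$ (h, i))}"

text \<open>The law of the corank of a uniformly random such matrix, meant for \<open>\<kappa> \<le> r\<close>.\<close>

definition redei_corank_pmf :: "nat \<Rightarrow> nat \<Rightarrow> nat pmf" where
  "redei_corank_pmf r \<kappa> = map_pmf kernel_dim (pmf_of_set (redei_matrices r \<kappa>))"

definition mu_redei :: "nat \<Rightarrow> nat \<Rightarrow> real" where
  "mu_redei r j = 1 / 2 ^ r * (\<Sum>\<kappa>=0..r. real (r choose \<kappa>) * pmf (redei_corank_pmf r \<kappa>) j)"

definition eta :: "enat \<Rightarrow> real \<Rightarrow> real" where
  "eta k t = (case k of
       enat n \<Rightarrow> \<Prod>j=1..n. 1 - 1 / t ^ j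
     | \<infinity> \<Rightarrow> \<Prod>j. 1 - 1 / t ^ Suc j)"

definition pi_CL :: "nat \<Rightarrow> real" where
  "pi_CL j = 1 / 2 ^ (j\<^sup>2) * eta \<infinity> 2 / (eta (enat j) 2)\<^sup>2"

text \<open>Extended-real valued, so that an upper bound on it includes absolute summability.\<close>

definition l1_norm :: "(nat \<Rightarrow> real) \<Rightarrow> ennreal" where
  "l1_norm f = (\<Sum>j. ennreal \<bar>f j\<bar>)"

text \<open>
  The operators \<^const>\<open>pmf_of_set\<close> and \<^const>\<open>prodinf\<close> are unspecified on empty or
  infinite sets and on divergent products respectively; neither case occurs here.
\<close>

lemma finite_redei_matrices: "finite (redei_matrices r \<kappa>)"
proof -
  have "(UNIV :: bit set) = {0, 1}"
    by (auto intro: bit.exhaust)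
  then have fin: "finite (UNIV :: bit set)"
    by (metis finite.emptyI finite.insertI)
  let ?I = "{..<r} \<times> {..<r}"
  have "redei_matrices r \<kappa> \<subseteq> (\<lambda>f. mat r r f) ` (?I \<rightarrow>\<^sub>E UNIV)"
  proof
    fix A assume "A \<in> redei_matrices r \<kappa>"
    then have "A \<in> carrier_mat r r"
      by (simp add: redei_matrices_def)
    then have "A = mat r r (restrict (\<lambda>p. A $$ p) ?I)"
      by (intro eq_matI) auto
    then show "A \<in> (\<lambda>f. mat r r f) ` (?I \<rightarrow>\<^sub>E UNIV)"
      by (metis (no_types, lifting) UNIV_I image_eqI restrict_PiE_iff)
  qed
  moreover have "finite ((\<lambda>f. mat r r f) ` (?I \<rightarrow>\<^sub>E (UNIV :: bit set)))"
    by (intro finite_imageI finite_PiE) (auto simp: fin)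
  ultimately show ?thesis
    by (rule finite_subset)
qed

lemma redei_matrices_nonempty:
  assumes "\<kappa> \<le> r"
  shows "redei_matrices r \<kappa> \<noteq> {}"
proof -
  have "mat r r (\<lambda>(i, h). if i < h \<and> h < \<kappa> then 1 else 0) \<in> redei_matrices r \<kappa>"
    using assms by (auto simp: redei_matrices_def)
  then show ?thesis
    by blast
qed

lemma eta_infinity_convergent:
  assumes "t > 1"
  shows "convergent_prod (\<lambda>j. 1 - 1 / t ^ Suc j :: real)"
proof -
  have "summable (\<lambda>j. (1 / t) * (1 / t) ^ j)"
    using assms by (intro summable_mult summable_geometric) auto
  moreover have "norm (1 - 1 / t ^ Suc j - 1) = (1 / t) * (1 / t) ^ j" for j
    using assms by (simp add: power_divide)
  ultimately have "summable (\<lambda>j. norm (1 - 1 / t ^ Suc j - 1))"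
    by simp
  then have "abs_convergent_prod (\<lambda>j. 1 - 1 / t ^ Suc j)"
    by (simp add: summable_imp_abs_convergent_prod)
  then show ?thesis
    by (rule abs_convergent_prod_imp_convergent_prod)
qed

end

theory Submission
  imports Defs
begin

text \<open>
  The proof is by moments. The number of linearly independent \<open>k\<close>-tuples in the kernel of a matrix of
  corank \<open>d\<close> is \<open>\<Prod>m<k. 2 ^ d - 2 ^ m\<close>, and all its Cohen-Lenstra moments are \<open>1\<close>. For fixed \<open>\<kappa>\<close>, all
  matrices \<open>A\<close> under consideration have the same \<open>A + A\<^sup>T\<close>, an alternating form, and they
  are a coset of the symmetric matrices. Hence an independent tuple is annihilated by some \<open>A\<close> only if it
  spans an isotropic subspace, and then by a proportion \<open>2 ^ (k choose 2) / 2 ^ (r * k)\<close> of all \<open>A\<close>. The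
  radical of the form has dimension at most \<open>r - \<kappa> + 1\<close>, so counting isotropic tuples vector by vector
  shows that the \<open>k\<close>-th moment is \<open>1\<close> up to an error of \<open>3 * 2 ^ ((k choose 2) + k) / 2 ^ \<kappa>\<close>. Inverting
  the moments by the \<open>q\<close>-binomial theorem bounds the distance of the laws by a multiple of
  \<open>2 powr (- \<kappa> / 2)\<close>, and averaging this over \<open>\<kappa>\<close> with binomial weights gives the rate
  \<open>(1 + sqrt (1 / 2)) / 2\<close>.
\<close>

section \<open>Vectors over the field with two elements\<close>

text \<open>As simplification rules these turn the field operations on \<open>bit\<close> into
  bitwise \<open>XOR\<close> and \<open>AND\<close>, where the ring laws used below no longer
  match.\<close>

declare add_bit_eq_xor [simp del] mult_bit_eq_and [simp del]

lemma card_carrier_vec_bit: "card (carrier_vec r :: bit vec set) = 2 ^ r"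
  and finite_carrier_vec_bit: "finite (carrier_vec r :: bit vec set)"
proof -
  have bij: "bij_betw (\<lambda>S. vec r (\<lambda>i. of_bool (i \<in> S))) (Pow {..<r}) (carrier_vec r :: bit vec set)"
  proof (rule bij_betwI[where g = "\<lambda>v. {i \<in> {..<r}. v $ i = 1}"])
    fix v :: "bit vec" assume "v \<in> carrier_vec r"
    then show "vec r (\<lambda>i. of_bool (i \<in> {i \<in> {..<r}. v $ i = 1})) = v"
      by (intro eq_vecI) auto
  qed auto
  show "card (carrier_vec r :: bit vec set) = 2 ^ r"
    using bij_betw_same_card[OF bij] by (simp add: card_Pow)
  show "finite (carrier_vec r :: bit vec set)"
    using bij_betw_finite[OF bij] by simp
qed

text \<open>Coordinates with respect to a basis of the kernel are arbitrary functions into a set of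
  two elements. This translates the corank into a cardinality, the only form in which it is used
  later.\<close>

lemma card_mat_kernel_bit:
  fixes A :: "bit mat"
  assumes A: "A \<in> carrier_mat nr nc"
  shows "card (mat_kernel A) = 2 ^ kernel_dim A"
proof -
  interpret kernel nr nc A by unfold_locales (rule A)
  obtain B where fin: "finite B" and basis: "basis B"
    using kernel_basis_exists[OF A] by blast
  have B: "B \<subseteq> mat_kernel A"
    using basis by (simp add: Ker.basis_def)
  have uniq: "\<forall>v. v \<in> mat_kernel A \<longrightarrow> (\<exists>!a. a \<in> B \<rightarrow>\<^sub>E (UNIV :: bit set) \<and> lincomb a B = v)"
    using Ker.basis_criterion[OF fin] B basis by simp
  have closed: "lincomb a B \<in> mat_kernel A" for a
    using Ker.lincomb_closed[of B a] B by auto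
  have "bij_betw (\<lambda>a. lincomb a B) (B \<rightarrow>\<^sub>E (UNIV :: bit set)) (mat_kernel A)"
    unfolding bij_betw_def inj_on_def
  proof (intro conjI ballI impI)
    fix a b assume "a \<in> B \<rightarrow>\<^sub>E (UNIV :: bit set)" "b \<in> B \<rightarrow>\<^sub>E (UNIV :: bit set)" "lincomb a B = lincomb b B"
    then show "a = b"
      using uniq closed by blast
  next
    show "(\<lambda>a. lincomb a B) ` (B \<rightarrow>\<^sub>E UNIV) = mat_kernel A"
      using uniq closed by blast
  qed
  then have "card (mat_kernel A) = card (B \<rightarrow>\<^sub>E (UNIV :: bit set))"
    by (metis bij_betw_same_card)
  also have "\<dots> = card (UNIV :: bit set) ^ card B"
    by (simp add: card_PiE fin)
  also have "(UNIV :: bit set) = {0, 1}"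
    by (auto intro: bit.exhaust)
  also have "card {0, 1 :: bit} = 2"
    by simp
  also have "card B = kernel_dim A"
    using Ker.dim_basis[OF fin basis] by simp
  finally show ?thesis
    by simp
qed

section \<open>Character sums and annihilators\<close>

text \<open>The nontrivial additive character of the field with two elements.\<close>

definition bit_sign :: "bit \<Rightarrow> real" where
  "bit_sign b = (if b = 0 then 1 else - 1)"

lemma bit_sign_0 [simp]: "bit_sign 0 = 1" and bit_sign_1 [simp]: "bit_sign 1 = - 1"
  by (simp_all add: bit_sign_def)

lemma bit_add_self [simp]: "a + a = (0 :: bit)"
  by (cases a) (simp_all)

lemma bit_sign_add: "bit_sign (a + b) = bit_sign a * bit_sign b"
  by (cases a; cases b) simp_all

lemma bit_vec_add_self: "v \<in> carrier_vec r \<Longrightarrow> v + v = 0\<^sub>v r" for v :: "bit vec"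
  by (intro eq_vecI) auto

lemma bit_vec_add_cancel:
  fixes v w :: "bit vec"
  assumes "v \<in> carrier_vec r" "w \<in> carrier_vec r"
  shows "v + w + w = v"
  using assms by (intro eq_vecI) (auto simp: add.assoc)

text \<open>The only scalars are 0 and 1, so closure under addition already gives a linear
  subspace.\<close>

definition bit_subspace :: "nat \<Rightarrow> bit vec set \<Rightarrow> bool" where
  "bit_subspace r W \<longleftrightarrow> W \<subseteq> carrier_vec r \<and> 0\<^sub>v r \<in> W \<and> (\<forall>u\<in>W. \<forall>w\<in>W. u + w \<in> W)"

lemma bit_subspaceD:
  assumes "bit_subspace r W"
  shows "W \<subseteq> carrier_vec r" "0\<^sub>v r \<in> W" "u \<in> W \<Longrightarrow> w \<in> W \<Longrightarrow> u + w \<in> W" "finite W"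
  using assms finite_subset[OF _ finite_carrier_vec_bit] by (auto simp: bit_subspace_def)

lemma bit_subspace_carrier: "bit_subspace r (carrier_vec r)"
  by (auto simp: bit_subspace_def)

lemma bit_subspace_kernel:
  assumes "A \<in> carrier_mat r r"
  shows "bit_subspace r (mat_kernel A)"
  using assms by (auto simp: bit_subspace_def mat_kernel mult_add_distrib_mat_vec)

text \<open>Orthogonality of characters: if \<open>f\<close> takes the value 1 at \<open>w0\<close>,
  translation by \<open>w0\<close> permutes \<open>W\<close> and flips every sign, so the sum equals
  its own negative.\<close>

lemma sum_bit_sign:
  assumes W: "bit_subspace r W"
    and f: "\<And>u w. u \<in> W \<Longrightarrow> w \<in> W \<Longrightarrow> f (u + w) = f u + f w"
  shows "(\<Sum>w\<in>W. bit_sign (f w)) = (if \<forall>w\<in>W. f w = 0 then real (card W) else 0)"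
proof (cases "\<forall>w\<in>W. f w = 0")
  case False
  then obtain w0 where w0: "w0 \<in> W" "f w0 = 1"
    by auto
  have "bij_betw (\<lambda>w. w + w0) W W"
    using bit_subspaceD[OF W] w0
    by (intro bij_betwI[where g = "\<lambda>w. w + w0"]) (auto intro!: bit_vec_add_cancel)
  then have "(\<Sum>w\<in>W. bit_sign (f w)) = (\<Sum>w\<in>W. bit_sign (f (w + w0)))"
    by (rule sum.reindex_bij_betw[symmetric])
  also have "\<dots> = (\<Sum>w\<in>W. - bit_sign (f w))"
    using w0 by (intro sum.cong) (simp_all add: f bit_sign_add)
  also have "\<dots> = - (\<Sum>w\<in>W. bit_sign (f w))"
    by (simp add: sum_negf)
  finally show ?thesis
    using False by auto
qed simp

text \<open>Both sides evaluate the double sum of \<open>bit_sign (F v w)\<close> over \<open>V \<times> W\<close>.\<close>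

lemma card_annihilators:
  fixes F :: "bit vec \<Rightarrow> bit vec \<Rightarrow> bit"
  assumes V: "bit_subspace r V" and W: "bit_subspace s W"
    and F1: "\<And>u v w. u \<in> V \<Longrightarrow> v \<in> V \<Longrightarrow> w \<in> W \<Longrightarrow> F (u + v) w = F u w + F v w"
    and F2: "\<And>u v w. u \<in> V \<Longrightarrow> v \<in> W \<Longrightarrow> w \<in> W \<Longrightarrow> F u (v + w) = F u v + F u w"
  shows "card W * card {v \<in> V. \<forall>w\<in>W. F v w = 0} = card V * card {w \<in> W. \<forall>v\<in>V. F v w = 0}"
proof -
  have fin: "finite V" "finite W"
    using bit_subspaceD(4) V W by auto
  have "(\<Sum>w\<in>W. bit_sign (F v w)) = (if \<forall>w\<in>W. F v w = 0 then real (card W) else 0)" if "v \<in> V" for v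
    by (rule sum_bit_sign[OF W]) (rule F2[OF that])
  then have "(\<Sum>v\<in>V. \<Sum>w\<in>W. bit_sign (F v w)) =
      (\<Sum>v\<in>V. if \<forall>w\<in>W. F v w = 0 then real (card W) else 0)"
    by simp
  also have "\<dots> = real (card W * card {v \<in> V. \<forall>w\<in>W. F v w = 0})"
    by (simp add: sum.inter_filter[OF fin(1), symmetric])
  finally have 1: "(\<Sum>v\<in>V. \<Sum>w\<in>W. bit_sign (F v w)) = real (card W * card {v \<in> V. \<forall>w\<in>W. F v w = 0})" .
  have "(\<Sum>v\<in>V. bit_sign (F v w)) = (if \<forall>v\<in>V. F v w = 0 then real (card V) else 0)" if "w \<in> W" for w
    by (rule sum_bit_sign[OF V]) (rule F1[OF _ _ that])
  then have "(\<Sum>w\<in>W. \<Sum>v\<in>V. bit_sign (F v w)) =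
      (\<Sum>w\<in>W. if \<forall>v\<in>V. F v w = 0 then real (card V) else 0)"
    by simp
  also have "\<dots> = real (card V * card {w \<in> W. \<forall>v\<in>V. F v w = 0})"
    by (simp add: sum.inter_filter[OF fin(2), symmetric])
  finally show ?thesis
    unfolding sum.swap[of _ V W] 1 of_nat_eq_iff .
qed

section \<open>Spans and independent lists\<close>

text \<open>With scalars 0 and 1, adjoining \<open>v\<close> adds just one translate of the old
  span. Lists grow at the head, so the vectors after \<open>v\<close> are the earlier ones, and
  counting can proceed vector by vector.\<close>

fun bit_span :: "nat \<Rightarrow> bit vec list \<Rightarrow> bit vec set" where
  "bit_span r [] = {0\<^sub>v r}"
| "bit_span r (v # vs) = bit_span r vs \<union> (+) v ` bit_span r vs"

fun bit_indep :: "nat \<Rightarrow> bit vec list \<Rightarrow> bool" where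
  "bit_indep r [] \<longleftrightarrow> True"
| "bit_indep r (v # vs) \<longleftrightarrow> v \<notin> bit_span r vs \<and> bit_indep r vs"

lemma bit_subspace_span: "set vs \<subseteq> carrier_vec r \<Longrightarrow> bit_subspace r (bit_span r vs)"
proof (induction vs)
  case (Cons v vs)
  then have S: "bit_subspace r (bit_span r vs)" and v: "v \<in> carrier_vec r"
    by auto
  note S' = bit_subspaceD[OF S]
  have 1: "v + u + w = v + (u + w)" "u + (v + w) = v + (u + w)" "(v + u) + (v + w) = u + w"
    if "u \<in> bit_span r vs" "w \<in> bit_span r vs" for u w
    using that S' v by (auto intro!: eq_vecI simp: algebra_simps subset_iff)
  show ?case
    unfolding bit_subspace_def using S' v by (auto simp: 1)
qed (auto simp: bit_subspace_def)

lemma bit_span_subset: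
  assumes "bit_subspace r K" "set vs \<subseteq> K"
  shows "bit_span r vs \<subseteq> K"
  using assms(2) by (induction vs) (use bit_subspaceD[OF assms(1)] in auto)

lemma set_subset_bit_span: "set vs \<subseteq> carrier_vec r \<Longrightarrow> set vs \<subseteq> bit_span r vs"
proof (induction vs)
  case (Cons v vs)
  then have "v + 0\<^sub>v r = v" "0\<^sub>v r \<in> bit_span r vs"
    using bit_subspaceD(2)[OF bit_subspace_span] by auto
  then have "v \<in> (+) v ` bit_span r vs"
    by (metis image_eqI)
  then show ?case
    using Cons by auto
qed auto

text \<open>Each new vector doubles the span: translation is injective, and a common element of the
  old span and its translate by \<open>v\<close> would put \<open>v\<close> into the old
  span.\<close>

lemma card_bit_span:
  assumes "set vs \<subseteq> carrier_vec r" "bit_indep r vs"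
  shows "card (bit_span r vs) = 2 ^ length vs"
  using assms
proof (induction vs)
  case (Cons v vs)
  have v: "v \<in> carrier_vec r"
    using Cons.prems by simp
  note S = bit_subspaceD[OF bit_subspace_span[of vs r]]
  have inj: "inj_on ((+) v) (bit_span r vs)"
  proof (rule inj_onI)
    fix u w assume "u \<in> bit_span r vs" "w \<in> bit_span r vs" "v + u = v + w"
    then show "u = w"
      using v S Cons.prems by (metis bit_vec_add_cancel comm_add_vec list.set_intros(2) subset_iff)
  qed
  have "bit_span r vs \<inter> (+) v ` bit_span r vs = {}"
  proof (rule ccontr)
    assume "bit_span r vs \<inter> (+) v ` bit_span r vs \<noteq> {}"
    then obtain u where u: "u \<in> bit_span r vs" "v + u \<in> bit_span r vs"
      by auto
    then have "v + u + u \<in> bit_span r vs"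
      using S Cons.prems by simp
    then show False
      using u v S(1) Cons.prems bit_vec_add_cancel[of v r u] by auto
  qed
  then show ?case
    using Cons S by (simp add: card_Un_disjoint card_image[OF inj])
qed simp

text \<open>The common device for counting independent, arbitrary and isotropic lists by choosing
  the head after the tail.\<close>

lemma sum_Cons_image:
  fixes f :: "'a list \<Rightarrow> 'b :: comm_monoid_add"
  assumes "finite L" "\<And>vs. vs \<in> L \<Longrightarrow> finite (E vs)"
  shows "sum f {v # vs | v vs. vs \<in> L \<and> v \<in> E vs} = (\<Sum>vs\<in>L. \<Sum>v\<in>E vs. f (v # vs))"
proof -
  have "{v # vs | v vs. vs \<in> L \<and> v \<in> E vs} = (\<lambda>(vs, v). v # vs) ` Sigma L E"
    by auto
  moreover have "inj_on (\<lambda>(vs, v). v # vs) (Sigma L E)"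
    by (auto simp: inj_on_def)
  ultimately show ?thesis
    using assms by (simp add: sum.reindex sum.Sigma case_prod_unfold)
qed

definition indep_lists :: "nat \<Rightarrow> bit vec set \<Rightarrow> nat \<Rightarrow> bit vec list set" where
  "indep_lists r K k = {vs. length vs = k \<and> set vs \<subseteq> K \<and> bit_indep r vs}"

lemma finite_indep_lists: "finite K \<Longrightarrow> finite (indep_lists r K k)"
  by (rule finite_subset[OF _ finite_lists_length_eq[of K k]]) (auto simp: indep_lists_def)

lemma indep_lists_Suc:
  "indep_lists r K (Suc k) = {v # vs | v vs. vs \<in> indep_lists r K k \<and> v \<in> K - bit_span r vs}"
  by (auto simp: indep_lists_def length_Suc_conv)

text \<open>A list of length \<open>k\<close> spans \<open>2 ^ k\<close> vectors of
  \<open>K\<close>, which are excluded as the next choice. Once no lists are left, the product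
  already has a zero factor, so negative later factors do no harm.\<close>

lemma card_indep_lists:
  assumes K: "bit_subspace r K"
  shows "real (card (indep_lists r K k)) = (\<Prod>m<k. real (card K) - 2 ^ m)"
proof (induction k)
  case 0
  have "indep_lists r K 0 = {[]}"
    by (auto simp: indep_lists_def)
  then show ?case
    by simp
next
  case (Suc k)
  note K' = bit_subspaceD[OF K]
  have ext: "real (card (K - bit_span r vs)) = real (card K) - 2 ^ k" if "vs \<in> indep_lists r K k" for vs
  proof -
    have vs: "set vs \<subseteq> K" "bit_indep r vs" "length vs = k"
      using that by (auto simp: indep_lists_def)
    have "bit_span r vs \<subseteq> K"
      by (rule bit_span_subset[OF K vs(1)])
    moreover have "card (bit_span r vs) = 2 ^ k"
      using card_bit_span[of vs r] vs K' by auto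
    ultimately show ?thesis
      using K'(4) card_mono[of K "bit_span r vs"]
      by (simp add: card_Diff_subset finite_subset of_nat_diff)
  qed
  have "real (card (indep_lists r K (Suc k))) = (\<Sum>vs\<in>indep_lists r K k. \<Sum>v\<in>K - bit_span r vs. 1)"
    unfolding indep_lists_Suc real_of_card
    by (subst sum_Cons_image) (auto simp: finite_indep_lists K'(4))
  also have "\<dots> = (\<Sum>vs\<in>indep_lists r K k. real (card K) - 2 ^ k)"
    by (intro sum.cong) (simp_all add: ext)
  finally show ?case
    using Suc by simp
qed

section \<open>Redei matrices annihilating a given list of vectors\<close>

unbundle no vec_syntax

lemma Suc_choose_two: "Suc n choose 2 = n + (n choose 2)"
  by (simp add: numeral_2_eq_2)

lemma mult_mat_zero_vec: "A \<in> carrier_mat nr nc \<Longrightarrow> A *\<^sub>v 0\<^sub>v nc = 0\<^sub>v nr"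
  by (intro eq_vecI) (auto simp: scalar_prod_def)

section \<open>The alternating form shared by all the matrices\<close>

text \<open>The Gram matrix of the form: all ones minus the identity on the first
  \<open>\<kappa>\<close> coordinates. By \<open>redei_add_transpose\<close> it is
  \<open>A + transpose_mat A\<close> for every admissible \<open>A\<close>.\<close>

definition form_mat :: "nat \<Rightarrow> nat \<Rightarrow> bit mat" where
  "form_mat r \<kappa> = mat r r (\<lambda>(i, h). of_bool (i < \<kappa> \<and> h < \<kappa> \<and> i \<noteq> h))"

definition form :: "nat \<Rightarrow> nat \<Rightarrow> bit vec \<Rightarrow> bit vec \<Rightarrow> bit" where
  "form r \<kappa> v w = scalar_prod v (form_mat r \<kappa> *\<^sub>v w)"

lemma form_mat_carrier [simp]: "form_mat r \<kappa> \<in> carrier_mat r r"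
  by (simp add: form_mat_def)

lemma form_mat_mult_carrier [simp]: "w \<in> carrier_vec r \<Longrightarrow> form_mat r \<kappa> *\<^sub>v w \<in> carrier_vec r"
  by (rule mult_mat_vec_carrier[OF form_mat_carrier])

lemma redei_carrier: "A \<in> redei_matrices r \<kappa> \<Longrightarrow> A \<in> carrier_mat r r"
  by (simp add: redei_matrices_def)

lemma redei_add_transpose:
  assumes A: "A \<in> redei_matrices r \<kappa>"
  shows "A + transpose_mat A = form_mat r \<kappa>"
proof (rule eq_matI)
  note Ac = redei_carrier[OF A]
  fix i h assume "i < dim_row (form_mat r \<kappa>)" "h < dim_col (form_mat r \<kappa>)"
  then have ih: "i < r" "h < r"
    by (simp_all add: form_mat_def)
  have 1: "A $$ (i, h) = A $$ (h, i) + 1" if "i < h" "h < \<kappa>"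
    using A that by (simp add: redei_matrices_def)
  have 2: "A $$ (h, i) = A $$ (i, h) + 1" if "h < i" "i < \<kappa>"
    using A that by (simp add: redei_matrices_def)
  have 3: "A $$ (i, h) = A $$ (h, i)" if "\<kappa> \<le> h"
    using A ih that by (simp add: redei_matrices_def)
  have 4: "A $$ (h, i) = A $$ (i, h)" if "\<kappa> \<le> i"
    using A ih that unfolding redei_matrices_def by blast
  have "(A + transpose_mat A) $$ (i, h) = A $$ (i, h) + A $$ (h, i)"
    using Ac ih by simp
  also have "\<dots> = of_bool (i < \<kappa> \<and> h < \<kappa> \<and> i \<noteq> h)"
  proof (cases "i < \<kappa> \<and> h < \<kappa> \<and> i \<noteq> h")
    case True
    then consider "i < h" "h < \<kappa>" | "h < i" "i < \<kappa>"
      by linarith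
    then show ?thesis
    proof cases
      case 1
      show ?thesis
        unfolding \<open>i < h \<Longrightarrow> h < \<kappa> \<Longrightarrow> A $$ (i, h) = A $$ (h, i) + 1\<close>[OF 1]
        using True by (cases "A $$ (h, i)") auto
    next
      case 2
      show ?thesis
        unfolding \<open>h < i \<Longrightarrow> i < \<kappa> \<Longrightarrow> A $$ (h, i) = A $$ (i, h) + 1\<close>[OF 2]
        using True by (cases "A $$ (i, h)") auto
    qed
  next
    case False
    then consider "\<kappa> \<le> h" | "\<kappa> \<le> i" | "i = h"
      by linarith
    then have "A $$ (i, h) = A $$ (h, i)"
      using 3 4 by cases auto
    then show ?thesis
      using False by simp
  qed
  finally show "(A + transpose_mat A) $$ (i, h) = form_mat r \<kappa> $$ (i, h)"
    using ih by (simp add: form_mat_def)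
qed (use redei_carrier[OF A] in \<open>simp_all add: form_mat_def\<close>)

text \<open>A symmetric summand changes both sides of each defining equation equally. Such
  translations later carry one fibre of \<open>A \<mapsto> A v\<close> to another.\<close>

lemma redei_add_symmetric:
  assumes "A \<in> redei_matrices r \<kappa>" "S \<in> carrier_mat r r" "\<kappa> \<le> r"
    and "\<And>i h. i < r \<Longrightarrow> h < r \<Longrightarrow> S $$ (i, h) = S $$ (h, i)"
  shows "A + S \<in> redei_matrices r \<kappa>"
  using assms by (auto simp: redei_matrices_def add_ac)

text \<open>Expanding \<open>A + transpose_mat A\<close> and moving the transpose across the scalar
  product. Consequently a matrix that kills both \<open>v\<close> and \<open>w\<close> forces the
  form to vanish on them.\<close>

lemma form_redei:
  assumes A: "A \<in> redei_matrices r \<kappa>" and v: "v \<in> carrier_vec r" and w: "w \<in> carrier_vec r"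
  shows "form r \<kappa> v w = scalar_prod v (A *\<^sub>v w) + scalar_prod w (A *\<^sub>v v)"
proof -
  note Ac = redei_carrier[OF A]
  have "form r \<kappa> v w = scalar_prod v (A *\<^sub>v w + transpose_mat A *\<^sub>v w)"
    unfolding form_def redei_add_transpose[OF A, symmetric]
    using Ac w by (subst add_mult_distrib_mat_vec) auto
  also have "\<dots> = scalar_prod v (A *\<^sub>v w) + scalar_prod v (transpose_mat A *\<^sub>v w)"
    using Ac v w by (intro scalar_prod_add_distrib) auto
  also have "scalar_prod v (transpose_mat A *\<^sub>v w) = scalar_prod (transpose_mat A *\<^sub>v w) v"
    using Ac v w by (intro comm_scalar_prod) auto
  also have "\<dots> = scalar_prod w (A *\<^sub>v v)"
    by (rule transpose_vec_mult_scalar[OF Ac v w])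
  finally show ?thesis .
qed

lemma form_add_left:
  assumes "u \<in> carrier_vec r" "v \<in> carrier_vec r" "w \<in> carrier_vec r"
  shows "form r \<kappa> (u + v) w = form r \<kappa> u w + form r \<kappa> v w"
  unfolding form_def using assms by (intro add_scalar_prod_distrib) auto

lemma form_add_right:
  assumes "u \<in> carrier_vec r" "v \<in> carrier_vec r" "w \<in> carrier_vec r"
  shows "form r \<kappa> u (v + w) = form r \<kappa> u v + form r \<kappa> u w"
  unfolding form_def using assms
  by (subst mult_add_distrib_mat_vec[OF form_mat_carrier]) (auto intro!: scalar_prod_add_distrib)

text \<open>For \<open>w = v\<close> the two summands in \<open>form_redei\<close> coincide and
  cancel in characteristic 2; \<open>\<kappa> \<le> r\<close> provides a matrix to which that lemma
  applies.\<close>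

lemma form_self:
  assumes "\<kappa> \<le> r" "v \<in> carrier_vec r"
  shows "form r \<kappa> v v = 0"
  using form_redei[of _ r \<kappa> v v] redei_matrices_nonempty[OF assms(1)] assms(2) by auto

lemma form_commute:
  assumes "\<kappa> \<le> r" "v \<in> carrier_vec r" "w \<in> carrier_vec r"
  shows "form r \<kappa> v w = form r \<kappa> w v"
proof -
  obtain A where "A \<in> redei_matrices r \<kappa>"
    using redei_matrices_nonempty[OF assms(1)] by auto
  then show ?thesis
    using form_redei assms by (simp add: add.commute)
qed

text \<open>Each vector is tested only against the span of the vectors after it, matching the
  recursion for annihilating matrices. \<open>isotropic_span\<close> recovers vanishing on the whole
  span, as the form is symmetric and alternating.\<close>

fun isotropic :: "nat \<Rightarrow> nat \<Rightarrow> bit vec list \<Rightarrow> bool" where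
  "isotropic r \<kappa> [] \<longleftrightarrow> True"
| "isotropic r \<kappa> (v # vs) \<longleftrightarrow> (\<forall>w\<in>bit_span r vs. form r \<kappa> v w = 0) \<and> isotropic r \<kappa> vs"

lemma isotropic_span:
  assumes \<kappa>: "\<kappa> \<le> r" and "isotropic r \<kappa> vs" "set vs \<subseteq> carrier_vec r"
    and "u \<in> bit_span r vs" "w \<in> bit_span r vs"
  shows "form r \<kappa> u w = 0"
  using assms(2-)
proof (induction vs arbitrary: u w)
  case Nil
  then show ?case
    using form_self[OF \<kappa>] by simp
next
  case (Cons v vs)
  have v: "v \<in> carrier_vec r" and vs: "set vs \<subseteq> carrier_vec r"
    using Cons.prems by auto
  have S: "x \<in> carrier_vec r" if "x \<in> bit_span r vs" for x
    using bit_subspaceD(1)[OF bit_subspace_span[OF vs]] that by auto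
  have iso: "form r \<kappa> v x = 0" "form r \<kappa> x v = 0" if "x \<in> bit_span r vs" for x
    using that Cons.prems(1) form_commute[OF \<kappa> v S[OF that]] by auto
  have IH: "form r \<kappa> x y = 0" if "x \<in> bit_span r vs" "y \<in> bit_span r vs" for x y
    using Cons that vs by auto
  show ?case
    using Cons.prems(3,4) v
    by (auto simp: form_add_left form_add_right S iso IH form_self[OF \<kappa>])
qed

section \<open>Orthogonal complements and dual vectors for the dot product\<close>

definition dot_perp :: "nat \<Rightarrow> bit vec list \<Rightarrow> bit vec set" where
  "dot_perp r vs = {u \<in> carrier_vec r. \<forall>w\<in>bit_span r vs. scalar_prod u w = 0}"

text \<open>\<open>card_annihilators\<close> for the dot product: unit vectors read off entries, so
  only the zero vector is orthogonal to everything.\<close>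

lemma card_dot_perp:
  assumes vs: "set vs \<subseteq> carrier_vec r" "bit_indep r vs"
  shows "2 ^ length vs * card (dot_perp r vs) = 2 ^ r"
proof -
  note S = bit_subspace_span[OF vs(1)]
  have carr: "w \<in> carrier_vec r" if "w \<in> bit_span r vs" for w
    using bit_subspaceD(1)[OF S] that by auto
  have "{w \<in> bit_span r vs. \<forall>v\<in>carrier_vec r. scalar_prod v w = 0} = {0\<^sub>v r}"
  proof -
    have "w = 0\<^sub>v r" if w: "w \<in> bit_span r vs" "\<forall>v\<in>carrier_vec r. scalar_prod v w = 0" for w
    proof (rule eq_vecI)
      fix i assume "i < dim_vec (0\<^sub>v r :: bit vec)"
      then have "scalar_prod (unit_vec r i) w = w $ i"
        using carr[OF w(1)] by simp
      then show "w $ i = 0\<^sub>v r $ i"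
        using w(2) \<open>i < _\<close> by auto
    qed (use carr[OF w(1)] in simp)
    moreover have "\<forall>v\<in>carrier_vec r. scalar_prod v (0\<^sub>v r) = (0 :: bit)"
      by simp
    ultimately show ?thesis
      using bit_subspaceD(2)[OF S] by blast
  qed
  moreover have "card (bit_span r vs) * card (dot_perp r vs) = card (carrier_vec r :: bit vec set) *
      card {w \<in> bit_span r vs. \<forall>v\<in>carrier_vec r. scalar_prod v w = 0}"
    unfolding dot_perp_def
    by (rule card_annihilators[OF bit_subspace_carrier S])
      (auto intro!: add_scalar_prod_distrib scalar_prod_add_distrib dest: carr)
  ultimately show ?thesis
    by (simp add: card_bit_span[OF vs] card_carrier_vec_bit)
qed

text \<open>Adjoining \<open>v\<close> halves the orthogonal complement. A vector lost in this way
  is orthogonal to the old span but not to \<open>v\<close>.\<close>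

lemma dual_vector_exists:
  assumes "set (v # vs) \<subseteq> carrier_vec r" "bit_indep r (v # vs)"
  obtains a where "a \<in> dot_perp r vs" "scalar_prod a v = 1"
proof -
  have "2 ^ length vs * (2 * card (dot_perp r (v # vs))) = 2 ^ r"
    using card_dot_perp[OF assms] by (simp add: mult_ac)
  moreover have "2 ^ length vs * card (dot_perp r vs) = 2 ^ r"
    using card_dot_perp[of vs r] assms by simp
  moreover have "(2 :: nat) ^ r > 0"
    by simp
  ultimately have "dot_perp r (v # vs) \<noteq> dot_perp r vs"
    by (metis add_0_left mult_2 mult_cancel_left mult_is_0 nat_less_le add_eq_self_zero)
  moreover have "dot_perp r (v # vs) \<subseteq> dot_perp r vs"
    by (auto simp: dot_perp_def)
  ultimately obtain a where a: "a \<in> dot_perp r vs" "a \<notin> dot_perp r (v # vs)"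
    by auto
  then obtain u where u: "u \<in> bit_span r vs" "scalar_prod a (v + u) \<noteq> 0"
    by (auto simp: dot_perp_def)
  have "u \<in> carrier_vec r"
    using bit_subspaceD(1)[OF bit_subspace_span[of vs r]] assms u by auto
  then have "scalar_prod a (v + u) = scalar_prod a v + scalar_prod a u"
    using assms a by (intro scalar_prod_add_distrib) (auto simp: dot_perp_def)
  then have "scalar_prod a v = 1"
    using u a by (auto simp: dot_perp_def)
  with a(1) show thesis
    by (rule that)
qed

section \<open>Matrices annihilating a list\<close>

text \<open>The symmetric matrix \<open>a u^T + u a^T + c a a^T\<close>. It kills every vector
  orthogonal to both \<open>a\<close> and \<open>u\<close>, and for \<open>a\<close> dual to
  \<open>v\<close> a suitable \<open>c\<close> makes it send \<open>v\<close> to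
  \<open>u\<close>.\<close>

definition sym_outer :: "nat \<Rightarrow> bit vec \<Rightarrow> bit vec \<Rightarrow> bit \<Rightarrow> bit mat" where
  "sym_outer r a u c = mat r r (\<lambda>(i, h). a $ i * u $ h + u $ i * a $ h + c * (a $ i * a $ h))"

lemma sym_outer_mult_vec:
  assumes "a \<in> carrier_vec r" "u \<in> carrier_vec r" "w \<in> carrier_vec r"
  shows "sym_outer r a u c *\<^sub>v w =
    scalar_prod u w \<cdot>\<^sub>v a + scalar_prod a w \<cdot>\<^sub>v u + (c * scalar_prod a w) \<cdot>\<^sub>v a"
proof (rule eq_vecI)
  fix i assume "i < dim_vec (scalar_prod u w \<cdot>\<^sub>v a + scalar_prod a w \<cdot>\<^sub>v u + (c * scalar_prod a w) \<cdot>\<^sub>v a)"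
  then have i: "i < r"
    using assms by simp
  then have "(sym_outer r a u c *\<^sub>v w) $ i =
      (\<Sum>h = 0..<r. (a $ i * u $ h + u $ i * a $ h + c * (a $ i * a $ h)) * w $ h)"
    using assms by (simp add: sym_outer_def scalar_prod_def row_def)
  also have "\<dots> = scalar_prod u w * a $ i + scalar_prod a w * u $ i + (c * scalar_prod a w) * a $ i"
    using assms
    by (simp add: scalar_prod_def sum_distrib_left sum_distrib_right sum.distrib algebra_simps)
  finally show "(sym_outer r a u c *\<^sub>v w) $ i =
      (scalar_prod u w \<cdot>\<^sub>v a + scalar_prod a w \<cdot>\<^sub>v u + (c * scalar_prod a w) \<cdot>\<^sub>v a) $ i"
    using i assms by simp
qed (use assms in \<open>simp add: sym_outer_def\<close>)

definition redei_killing :: "nat \<Rightarrow> nat \<Rightarrow> bit vec list \<Rightarrow> bit mat set" where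
  "redei_killing r \<kappa> vs = {A \<in> redei_matrices r \<kappa>. \<forall>w\<in>bit_span r vs. A *\<^sub>v w = 0\<^sub>v r}"

lemma finite_redei_killing [simp]: "finite (redei_killing r \<kappa> vs)"
  using finite_redei_matrices by (simp add: redei_killing_def)

lemma redei_killing_Cons:
  assumes "v \<in> carrier_vec r" "set vs \<subseteq> carrier_vec r"
  shows "redei_killing r \<kappa> (v # vs) = {A \<in> redei_killing r \<kappa> vs. A *\<^sub>v v = 0\<^sub>v r}"
proof -
  note S = bit_subspaceD[OF bit_subspace_span[OF assms(2)]]
  have add: "A *\<^sub>v (v + w) = A *\<^sub>v v + A *\<^sub>v w" if "A \<in> redei_matrices r \<kappa>" "w \<in> bit_span r vs" for A w
    using redei_carrier[OF that(1)] assms S(1) that(2) by (intro mult_add_distrib_mat_vec) auto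
  have zero: "A *\<^sub>v v = 0\<^sub>v r" if "A \<in> redei_killing r \<kappa> (v # vs)" for A
  proof -
    have "v + 0\<^sub>v r \<in> bit_span r (v # vs)"
      using S(2) by simp
    then have "A *\<^sub>v (v + 0\<^sub>v r) = 0\<^sub>v r"
      using that unfolding redei_killing_def by blast
    then show ?thesis
      using assms(1) by simp
  qed
  show ?thesis
  proof (intro equalityI subsetI)
    fix A assume "A \<in> redei_killing r \<kappa> (v # vs)"
    then show "A \<in> {A \<in> redei_killing r \<kappa> vs. A *\<^sub>v v = 0\<^sub>v r}"
      using zero by (auto simp: redei_killing_def)
  next
    fix A assume "A \<in> {A \<in> redei_killing r \<kappa> vs. A *\<^sub>v v = 0\<^sub>v r}"
    then show "A \<in> redei_killing r \<kappa> (v # vs)"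
      by (auto simp: redei_killing_def add)
  qed
qed

text \<open>If \<open>A\<close> kills \<open>v\<close> and \<open>w\<close>, both summands in
  \<open>form_redei\<close> vanish, contradicting the value of the form.\<close>

lemma redei_killing_Cons_empty:
  assumes vs: "v \<in> carrier_vec r" "set vs \<subseteq> carrier_vec r"
    and w: "w \<in> bit_span r vs" "form r \<kappa> v w \<noteq> 0"
  shows "redei_killing r \<kappa> (v # vs) = {}"
proof -
  have "w \<in> carrier_vec r"
    using w(1) bit_subspaceD(1)[OF bit_subspace_span[OF vs(2)]] by auto
  then have "form r \<kappa> v w = 0" if "A \<in> redei_killing r \<kappa> (v # vs)" for A
    using that w(1) vs form_redei[of A r \<kappa> v w]
    unfolding redei_killing_Cons[OF vs] by (auto simp: redei_killing_def)
  then show ?thesis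
    using w(2) by auto
qed

text \<open>The fibres of \<open>A \<mapsto> A v\<close> are translates of each other by symmetric matrices.\<close>

lemma card_redei_killing_Cons:
  assumes \<kappa>: "\<kappa> \<le> r" and vs: "set (v # vs) \<subseteq> carrier_vec r" "bit_indep r (v # vs)"
    and iso: "\<And>w. w \<in> bit_span r vs \<Longrightarrow> form r \<kappa> v w = 0"
  shows "2 ^ r * card (redei_killing r \<kappa> (v # vs)) = 2 ^ length vs * card (redei_killing r \<kappa> vs)"
proof -
  have v: "v \<in> carrier_vec r" and vs': "set vs \<subseteq> carrier_vec r" "bit_indep r vs"
    using vs by auto
  have carr: "w \<in> carrier_vec r" if "w \<in> bit_span r vs" for w
    using bit_subspaceD(1)[OF bit_subspace_span[OF vs'(1)]] that by auto
  define fib where "fib u = {A \<in> redei_killing r \<kappa> vs. A *\<^sub>v v = u}" for u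
  obtain a where a: "a \<in> dot_perp r vs" "scalar_prod a v = 1"
    by (rule dual_vector_exists[OF vs])
  \<comment> \<open>In \<open>form_redei\<close> the left side vanishes by isotropy and
    \<open>A w = 0\<close>, so \<open>w\<close> is orthogonal to \<open>A v\<close>: this restricts
    the values of \<open>A v\<close>.\<close>
  have image: "A *\<^sub>v v \<in> dot_perp r vs" if A: "A \<in> redei_killing r \<kappa> vs" for A
  proof -
    have A': "A \<in> redei_matrices r \<kappa>"
      using A by (simp add: redei_killing_def)
    have Av: "A *\<^sub>v v \<in> carrier_vec r"
      using redei_carrier[OF A'] v by simp
    have "scalar_prod (A *\<^sub>v v) w = 0" if w: "w \<in> bit_span r vs" for w
    proof -
      have "scalar_prod v (A *\<^sub>v w) = 0"
        using A w v by (simp add: redei_killing_def)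
      then have "scalar_prod w (A *\<^sub>v v) = 0"
        using form_redei[OF A' v carr[OF w]] iso[OF w] by simp
      then show ?thesis
        using comm_scalar_prod[OF Av carr[OF w]] by simp
    qed
    then show ?thesis
      using Av by (simp add: dot_perp_def)
  qed
  have fib: "card (fib u) = card (redei_killing r \<kappa> (v # vs))" if u: "u \<in> dot_perp r vs" for u
  proof -
    have ac: "a \<in> carrier_vec r" and uc: "u \<in> carrier_vec r"
      using a u by (auto simp: dot_perp_def)
    \<comment> \<open>Since \<open>a\<close> pairs to 1 with \<open>v\<close>, \<open>S v\<close> is
      \<open>u\<close> plus \<open>scalar_prod u v + c\<close> times \<open>a\<close>; the choice of
      \<open>c\<close> cancels the second part in characteristic 2.\<close>
    define S where "S = sym_outer r a u (scalar_prod u v)"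
    have Sc: "S \<in> carrier_mat r r"
      by (simp add: S_def sym_outer_def)
    have Ssym: "S $$ (i, h) = S $$ (h, i)" if "i < r" "h < r" for i h
      using that by (simp add: S_def sym_outer_def algebra_simps)
    have Sw: "S *\<^sub>v w = 0\<^sub>v r" if w: "w \<in> bit_span r vs" for w
    proof -
      have "scalar_prod u w = 0" "scalar_prod a w = 0"
        using u a w by (auto simp: dot_perp_def)
      then show ?thesis
        unfolding S_def sym_outer_mult_vec[OF ac uc carr[OF w]] using ac uc
        by (intro eq_vecI) auto
    qed
    have Sv: "S *\<^sub>v v = u"
      unfolding S_def sym_outer_mult_vec[OF ac uc v] a(2) using ac uc
      by (intro eq_vecI) (auto simp: algebra_simps)
    have kill: "A + S \<in> redei_killing r \<kappa> vs" "(A + S) *\<^sub>v v = A *\<^sub>v v + u" "A + S + S = A"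
      if A: "A \<in> redei_killing r \<kappa> vs" for A
    proof -
      have A': "A \<in> redei_matrices r \<kappa>"
        using A by (simp add: redei_killing_def)
      note Ac = redei_carrier[OF A']
      have "A + S \<in> redei_matrices r \<kappa>"
        by (rule redei_add_symmetric[OF A' Sc \<kappa> Ssym])
      moreover have "(A + S) *\<^sub>v w = 0\<^sub>v r" if "w \<in> bit_span r vs" for w
        using A that Sw[OF that] carr[OF that]
        by (subst add_mult_distrib_mat_vec[OF Ac Sc]) (auto simp: redei_killing_def)
      ultimately show "A + S \<in> redei_killing r \<kappa> vs"
        by (simp add: redei_killing_def)
      show "(A + S) *\<^sub>v v = A *\<^sub>v v + u"
        using v Sv by (subst add_mult_distrib_mat_vec[OF Ac Sc]) auto
      show "A + S + S = A"
        using Ac Sc by (intro eq_matI) (auto simp: add.assoc)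
    qed
    have "bij_betw (\<lambda>A. A + S) (redei_killing r \<kappa> (v # vs)) (fib u)"
      unfolding redei_killing_Cons[OF v vs'(1)] fib_def
      using uc bit_vec_add_self[OF uc]
      by (intro bij_betwI[where g = "\<lambda>A. A + S"]) (auto simp: kill)
    then show ?thesis
      by (simp add: bij_betw_same_card)
  qed
  have fin: "finite (dot_perp r vs)"
    by (simp add: dot_perp_def finite_carrier_vec_bit)
  \<comment> \<open>The fibres over \<open>dot_perp r vs\<close> partition the old set, and each is
    as large as the fibre over zero, which is the new set.\<close>
  have "redei_killing r \<kappa> vs = (\<Union>u\<in>dot_perp r vs. fib u)"
    using image by (auto simp: fib_def)
  also have "card \<dots> = (\<Sum>u\<in>dot_perp r vs. card (fib u))"
    using fin by (intro card_UN_disjoint) (auto simp: fib_def)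
  also have "(\<Sum>u\<in>dot_perp r vs. card (fib u)) = card (dot_perp r vs) * card (redei_killing r \<kappa> (v # vs))"
    by (simp add: fib)
  finally show ?thesis
    using card_dot_perp[OF vs'] by (metis mult.assoc)
qed

text \<open>Adjoining a vector to \<open>m\<close> others keeps a proportion
  \<open>2 ^ m / 2 ^ r\<close> of the matrices, or none if isotropy fails. The exponents
  \<open>0, ..., k - 1\<close> add up to \<open>k choose 2\<close>.\<close>

lemma card_redei_killing:
  assumes \<kappa>: "\<kappa> \<le> r" and vs: "set vs \<subseteq> carrier_vec r" "bit_indep r vs"
  shows "2 ^ (r * length vs) * card (redei_killing r \<kappa> vs) =
    (if isotropic r \<kappa> vs then 2 ^ (length vs choose 2) * card (redei_matrices r \<kappa>) else 0)"
  using vs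
proof (induction vs)
  case Nil
  have "redei_killing r \<kappa> [] = redei_matrices r \<kappa>"
    by (auto simp: redei_killing_def mult_mat_zero_vec dest: redei_carrier)
  then show ?case
    by (simp add: binomial_eq_0)
next
  case (Cons v vs)
  have v: "v \<in> carrier_vec r" and vs: "set vs \<subseteq> carrier_vec r"
    using Cons.prems by auto
  show ?case
  proof (cases "\<forall>w\<in>bit_span r vs. form r \<kappa> v w = 0")
    case True
    then have "2 ^ r * card (redei_killing r \<kappa> (v # vs)) = 2 ^ length vs * card (redei_killing r \<kappa> vs)"
      using card_redei_killing_Cons[OF \<kappa> Cons.prems] by blast
    then have "2 ^ (r * length (v # vs)) * card (redei_killing r \<kappa> (v # vs)) =
        2 ^ length vs * (2 ^ (r * length vs) * card (redei_killing r \<kappa> vs))"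
      by (simp add: power_add mult_ac)
    also have "2 ^ (r * length vs) * card (redei_killing r \<kappa> vs) =
        (if isotropic r \<kappa> vs then 2 ^ (length vs choose 2) * card (redei_matrices r \<kappa>) else 0)"
      using Cons by simp
    finally show ?thesis
      using True by (auto simp: power_add Suc_choose_two)
  next
    case False
    then show ?thesis
      using redei_killing_Cons_empty[OF v vs] by auto
  qed
qed

section \<open>Moments of the corank\<close>

definition isotropic_lists :: "nat \<Rightarrow> nat \<Rightarrow> nat \<Rightarrow> bit vec list set" where
  "isotropic_lists r \<kappa> k = {vs \<in> indep_lists r (carrier_vec r) k. isotropic r \<kappa> vs}"

lemma finite_isotropic_lists [simp]: "finite (isotropic_lists r \<kappa> k)"
  by (simp add: isotropic_lists_def finite_indep_lists finite_carrier_vec_bit)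

text \<open>The expected number of independent \<open>k\<close>-tuples in the kernel, in evaluated
  form; \<open>sum_card_indep_lists_kernel\<close> identifies it as such when
  \<open>\<kappa> \<le> r\<close>.\<close>

definition corank_moment :: "nat \<Rightarrow> nat \<Rightarrow> nat \<Rightarrow> real" where
  "corank_moment r \<kappa> k = real (card (isotropic_lists r \<kappa> k)) * 2 ^ (k choose 2) / 2 ^ (r * k)"

text \<open>Double counting of pairs of a matrix and an independent list in its kernel: by matrices
  with \<open>card_indep_lists\<close>, by lists with \<open>card_redei_killing\<close>.\<close>

lemma sum_card_indep_lists_kernel:
  assumes \<kappa>: "\<kappa> \<le> r"
  shows "(\<Sum>A\<in>redei_matrices r \<kappa>. \<Prod>m<k. 2 ^ kernel_dim A - 2 ^ m) =
    real (card (redei_matrices r \<kappa>)) * corank_moment r \<kappa> k"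
proof -
  let ?I = "indep_lists r (carrier_vec r) k"
  have "(\<Prod>m<k. 2 ^ kernel_dim A - 2 ^ m) = (\<Sum>vs\<in>?I. of_bool (A \<in> redei_killing r \<kappa> vs) :: real)"
    if A: "A \<in> redei_matrices r \<kappa>" for A
  proof -
    note Ac = redei_carrier[OF A]
    note K = bit_subspace_kernel[OF Ac]
    have "A \<in> redei_killing r \<kappa> vs \<longleftrightarrow> set vs \<subseteq> mat_kernel A" if "set vs \<subseteq> carrier_vec r" for vs
    proof
      assume "A \<in> redei_killing r \<kappa> vs"
      then show "set vs \<subseteq> mat_kernel A"
        using set_subset_bit_span[OF that] that unfolding mat_kernel[OF Ac] redei_killing_def by blast
    next
      assume "set vs \<subseteq> mat_kernel A"
      then show "A \<in> redei_killing r \<kappa> vs"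
        using bit_span_subset[OF K] A unfolding mat_kernel[OF Ac] redei_killing_def by blast
    qed
    then have "indep_lists r (mat_kernel A) k = {vs \<in> ?I. A \<in> redei_killing r \<kappa> vs}"
      using bit_subspaceD(1)[OF K] by (auto simp: indep_lists_def)
    then have "real (card (indep_lists r (mat_kernel A) k)) =
        (\<Sum>vs\<in>?I. of_bool (A \<in> redei_killing r \<kappa> vs))"
      by (simp add: finite_indep_lists finite_carrier_vec_bit sum_of_bool_eq Int_def)
    then show ?thesis
      using card_indep_lists[OF K, of k] by (simp add: card_mat_kernel_bit[OF Ac])
  qed
  then have "(\<Sum>A\<in>redei_matrices r \<kappa>. \<Prod>m<k. 2 ^ kernel_dim A - 2 ^ m) =
      (\<Sum>A\<in>redei_matrices r \<kappa>. \<Sum>vs\<in>?I. of_bool (A \<in> redei_killing r \<kappa> vs) :: real)"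
    by simp
  also have "\<dots> = (\<Sum>vs\<in>?I. \<Sum>A\<in>redei_matrices r \<kappa>. of_bool (A \<in> redei_killing r \<kappa> vs))"
    by (rule sum.swap)
  also have "\<dots> = (\<Sum>vs\<in>?I. real (card (redei_killing r \<kappa> vs)))"
    by (intro sum.cong) (auto simp: finite_redei_matrices sum_of_bool_eq redei_killing_def Int_def)
  also have "\<dots> = (\<Sum>vs\<in>?I. if isotropic r \<kappa> vs
      then 2 ^ (k choose 2) * real (card (redei_matrices r \<kappa>)) / 2 ^ (r * k) else 0)"
  proof (intro sum.cong refl)
    fix vs assume "vs \<in> ?I"
    then have vs: "set vs \<subseteq> carrier_vec r" "bit_indep r vs" "length vs = k"
      by (auto simp: indep_lists_def)
    have "2 ^ (r * k) * real (card (redei_killing r \<kappa> vs)) =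
        (if isotropic r \<kappa> vs then 2 ^ (k choose 2) * real (card (redei_matrices r \<kappa>)) else 0)"
      using arg_cong[OF card_redei_killing[OF \<kappa> vs(1,2)], of real] vs(3)
      by (simp split: if_splits)
    then show "real (card (redei_killing r \<kappa> vs)) = (if isotropic r \<kappa> vs
        then 2 ^ (k choose 2) * real (card (redei_matrices r \<kappa>)) / 2 ^ (r * k) else 0)"
      by (simp add: field_simps split: if_splits)
  qed
  also have "\<dots> = real (card (redei_matrices r \<kappa>)) * corank_moment r \<kappa> k"
    by (simp add: sum.inter_filter[symmetric] finite_indep_lists finite_carrier_vec_bit
        corank_moment_def isotropic_lists_def)
  finally show ?thesis .
qed

section \<open>The radical of the form\<close>

definition form_radical :: "nat \<Rightarrow> nat \<Rightarrow> bit vec set" where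
  "form_radical r \<kappa> = {w \<in> carrier_vec r. \<forall>v\<in>carrier_vec r. form r \<kappa> v w = 0}"

lemma finite_form_radical: "finite (form_radical r \<kappa>)"
  by (simp add: form_radical_def finite_carrier_vec_bit)

lemma zero_mem_form_radical: "0\<^sub>v r \<in> form_radical r \<kappa>"
  by (auto simp: form_radical_def form_def mult_mat_zero_vec[OF form_mat_carrier])

text \<open>The equations \<open>form (e\<^sub>h) w = 0\<close> say that the first \<open>\<kappa>\<close> entries of \<open>w\<close> all agree with their sum.\<close>

lemma card_form_radical:
  assumes \<kappa>: "\<kappa> \<le> r"
  shows "card (form_radical r \<kappa>) \<le> 2 * 2 ^ (r - \<kappa>)"
proof -
  define \<sigma> where "\<sigma> w = (\<Sum>i<\<kappa>. w $ i)" for w :: "bit vec"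
  \<comment> \<open>A vector of the radical is determined by the common value
    \<open>\<sigma>\<close> of its first \<open>\<kappa>\<close> entries and by its remaining
    entries, so \<open>g\<close> is injective there.\<close>
  define g where "g w = (\<sigma> w, vec (r - \<kappa>) (\<lambda>i. w $ (i + \<kappa>)))" for w
  have head: "w $ h = \<sigma> w" if w: "w \<in> form_radical r \<kappa>" and h: "h < \<kappa>" for w h
  proof -
    have wc: "w \<in> carrier_vec r" and "form r \<kappa> (unit_vec r h) w = 0"
      using w by (auto simp: form_radical_def)
    then have "0 = scalar_prod (row (form_mat r \<kappa>) h) w"
      using h \<kappa> form_mat_mult_carrier[OF wc, of \<kappa>] by (simp add: form_def form_mat_def)
    also have "\<dots> = (\<Sum>i = 0..<r. of_bool (i < \<kappa> \<and> h \<noteq> i) * w $ i)"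
      using wc h \<kappa> by (simp add: scalar_prod_def form_mat_def)
    also have "\<dots> = (\<Sum>i\<in>{..<\<kappa>} - {h}. w $ i)"
      using h \<kappa> by (intro sum.mono_neutral_cong_right) auto
    finally have "(\<Sum>i\<in>{..<\<kappa>} - {h}. w $ i) = 0" ..
    then show ?thesis
      unfolding \<sigma>_def using h by (subst sum.remove[of _ h]) auto
  qed
  have "inj_on g (form_radical r \<kappa>)"
  proof (rule inj_onI)
    fix u w assume u: "u \<in> form_radical r \<kappa>" and w: "w \<in> form_radical r \<kappa>" and "g u = g w"
    then have \<sigma>: "\<sigma> u = \<sigma> w"
      and tail: "vec (r - \<kappa>) (\<lambda>i. u $ (i + \<kappa>)) = vec (r - \<kappa>) (\<lambda>i. w $ (i + \<kappa>))"
      by (auto simp: g_def)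
    have dim: "dim_vec u = r" "dim_vec w = r"
      using u w by (auto simp: form_radical_def)
    show "u = w"
    proof (rule eq_vecI)
      fix i assume "i < dim_vec w"
      then have i: "i < r"
        using dim by simp
      show "u $ i = w $ i"
      proof (cases "i < \<kappa>")
        case True
        then show ?thesis
          using head u w \<sigma> by simp
      next
        case False
        then have "i - \<kappa> < r - \<kappa>" "i - \<kappa> + \<kappa> = i"
          using i by auto
        then show ?thesis
          using arg_cong[OF tail, of "\<lambda>v. v $ (i - \<kappa>)"] by simp
      qed
    qed (simp add: dim)
  qed
  moreover have "g ` form_radical r \<kappa> \<subseteq> {0, 1} \<times> carrier_vec (r - \<kappa>)"
    by (auto simp: g_def)
  moreover have "finite ({0, 1 :: bit} \<times> (carrier_vec (r - \<kappa>) :: bit vec set))"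
    by (simp add: finite_carrier_vec_bit)
  ultimately have "card (form_radical r \<kappa>) \<le> card ({0, 1 :: bit} \<times> (carrier_vec (r - \<kappa>) :: bit vec set))"
    by (metis card_inj_on_le)
  also have "\<dots> = 2 * 2 ^ (r - \<kappa>)"
    by (simp add: card_cartesian_product card_carrier_vec_bit)
  finally show ?thesis .
qed

section \<open>Average intersection of a span with a fixed set\<close>

text \<open>Lists without any condition, over which averages are easy to compute; they serve as an
  upper bound for sums over isotropic lists.\<close>

definition vec_lists :: "nat \<Rightarrow> nat \<Rightarrow> bit vec list set" where
  "vec_lists r k = {vs. set vs \<subseteq> carrier_vec r \<and> length vs = k}"

lemma finite_vec_lists: "finite (vec_lists r k)"
  by (simp add: vec_lists_def finite_lists_length_eq finite_carrier_vec_bit)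

lemma card_vec_lists: "card (vec_lists r k) = 2 ^ (r * k)"
  by (simp add: vec_lists_def card_lists_length_eq finite_carrier_vec_bit card_carrier_vec_bit power_mult)

lemma card_bit_span_le: "card (bit_span r vs) \<le> 2 ^ length vs"
proof (induction vs)
  case (Cons v vs)
  have fin: "finite (bit_span r vs)" for vs
    by (induction vs) auto
  have "card (bit_span r (v # vs)) \<le> card (bit_span r vs) + card ((+) v ` bit_span r vs)"
    by (simp add: card_Un_le)
  also have "card ((+) v ` bit_span r vs) \<le> card (bit_span r vs)"
    by (rule card_image_le[OF fin])
  finally show ?case
    using Cons by simp
qed simp

text \<open>\<open>bit_span r vs \<inter> R\<close> grows with a new vector \<open>v\<close> only if \<open>v + u \<in> R\<close> for some \<open>u\<close> in the old span.\<close>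

lemma sum_card_span_Int:
  assumes R: "R \<subseteq> carrier_vec r"
  shows "2 ^ r * (\<Sum>vs\<in>vec_lists r k. card (bit_span r vs \<inter> R)) \<le> 2 ^ (r * k) * (2 ^ r + 2 ^ k * card R)"
proof (induction k)
  case 0
  have "vec_lists r 0 = {[]}"
    by (auto simp: vec_lists_def)
  moreover have "card ({0\<^sub>v r} \<inter> R) \<le> 1"
    by (metis Int_lower1 card.empty card_mono card_insert_disjoint empty_iff finite.intros One_nat_def)
  ultimately show ?case
    by (simp add: trans_le_add1)
next
  case (Suc k)
  have finR: "finite R"
    using R finite_carrier_vec_bit by (rule finite_subset)
  have step: "(\<Sum>v\<in>carrier_vec r. card (bit_span r (v # vs) \<inter> R)) \<le>
      2 ^ r * card (bit_span r vs \<inter> R) + 2 ^ k * card R" if vs: "vs \<in> vec_lists r k" for vs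
  proof -
    define S where "S = bit_span r vs"
    have "set vs \<subseteq> carrier_vec r" and len: "length vs = k"
      using vs by (auto simp: vec_lists_def)
    then have S: "S \<subseteq> carrier_vec r" "finite S" "card S \<le> 2 ^ k"
      using bit_subspaceD(1,4)[OF bit_subspace_span[of vs r]] card_bit_span_le[of r vs]
      by (auto simp: S_def)
    have "(\<Sum>v\<in>carrier_vec r. card (bit_span r (v # vs) \<inter> R)) \<le>
        (\<Sum>v\<in>carrier_vec r. card (S \<inter> R) + card {u \<in> S. v + u \<in> R})"
    proof (rule sum_mono)
      fix v :: "bit vec"
      have "bit_span r (v # vs) \<inter> R = (S \<inter> R) \<union> (+) v ` {u \<in> S. v + u \<in> R}"
        by (auto simp: S_def)
      then have "card (bit_span r (v # vs) \<inter> R) \<le> card (S \<inter> R) + card ((+) v ` {u \<in> S. v + u \<in> R})"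
        by (simp add: card_Un_le)
      also have "card ((+) v ` {u \<in> S. v + u \<in> R}) \<le> card {u \<in> S. v + u \<in> R}"
        using S by (intro card_image_le) auto
      finally show "card (bit_span r (v # vs) \<inter> R) \<le> card (S \<inter> R) + card {u \<in> S. v + u \<in> R}"
        by simp
    qed
    also have "\<dots> = 2 ^ r * card (S \<inter> R) + (\<Sum>v\<in>carrier_vec r. card {u \<in> S. v + u \<in> R})"
      by (simp add: sum.distrib card_carrier_vec_bit)
    \<comment> \<open>After exchanging the sums, \<open>u\<close> is fixed and
      \<open>v \<mapsto> v + u\<close> is injective into \<open>R\<close>.\<close>
    also have "(\<Sum>v\<in>carrier_vec r. card {u \<in> S. v + u \<in> R}) =
        (\<Sum>u\<in>S. card {v \<in> carrier_vec r. v + u \<in> R})"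
      unfolding card_eq_sum by (rule sum.swap_restrict[OF finite_carrier_vec_bit S(2)])
    also have "\<dots> \<le> (\<Sum>u\<in>S. card R)"
    proof (rule sum_mono)
      fix u assume "u \<in> S"
      then have u: "u \<in> carrier_vec r"
        using S by auto
      have "inj_on (\<lambda>v. v + u) {v \<in> carrier_vec r. v + u \<in> R}"
        using u by (intro inj_on_inverseI[where g = "\<lambda>v. v + u"]) (auto intro: bit_vec_add_cancel)
      then show "card {v \<in> carrier_vec r. v + u \<in> R} \<le> card R"
        using finR by (intro card_inj_on_le[where f = "\<lambda>v. v + u"]) auto
    qed
    also have "\<dots> \<le> 2 ^ k * card R"
      using S(3) by simp
    finally show ?thesis
      by (simp add: S_def)
  qed
  have "vec_lists r (Suc k) = {v # vs | v vs. vs \<in> vec_lists r k \<and> v \<in> carrier_vec r}"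
    by (auto simp: vec_lists_def length_Suc_conv)
  then have "(\<Sum>vs\<in>vec_lists r (Suc k). card (bit_span r vs \<inter> R)) =
      (\<Sum>vs\<in>vec_lists r k. \<Sum>v\<in>carrier_vec r. card (bit_span r (v # vs) \<inter> R))"
    using sum_Cons_image[of "vec_lists r k" "\<lambda>_. carrier_vec r" "\<lambda>vs. card (bit_span r vs \<inter> R)"]
    by (simp only: finite_vec_lists finite_carrier_vec_bit)
  also have "\<dots> \<le> (\<Sum>vs\<in>vec_lists r k. 2 ^ r * card (bit_span r vs \<inter> R) + 2 ^ k * card R)"
    by (intro sum_mono step)
  also have "\<dots> = 2 ^ r * (\<Sum>vs\<in>vec_lists r k. card (bit_span r vs \<inter> R)) + 2 ^ (r * k) * (2 ^ k * card R)"
    by (simp add: sum.distrib sum_distrib_left card_vec_lists)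
  also have "\<dots> \<le> 2 ^ (r * k) * (2 ^ r + 2 ^ k * card R) + 2 ^ (r * k) * (2 ^ k * card R)"
    using Suc by simp
  also have "\<dots> = 2 ^ (r * k) * (2 ^ r + 2 ^ Suc k * card R)"
    by (simp add: algebra_simps)
  finally have "2 ^ r * (\<Sum>vs\<in>vec_lists r (Suc k). card (bit_span r vs \<inter> R)) \<le>
      2 ^ r * (2 ^ (r * k) * (2 ^ r + 2 ^ Suc k * card R))"
    by simp
  then show ?case
    by (simp add: power_add mult_ac)
qed

section \<open>Extending an isotropic list by one vector\<close>

definition form_perp :: "nat \<Rightarrow> nat \<Rightarrow> bit vec list \<Rightarrow> bit vec set" where
  "form_perp r \<kappa> vs = {v \<in> carrier_vec r. \<forall>w\<in>bit_span r vs. form r \<kappa> v w = 0}"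

text \<open>\<open>card_annihilators\<close> for the form: the vectors of the span orthogonal to the
  whole space are those in the radical. This intersection measures the deviation from a
  nondegenerate form.\<close>

lemma card_form_perp:
  assumes vs: "set vs \<subseteq> carrier_vec r" "bit_indep r vs"
  shows "2 ^ length vs * card (form_perp r \<kappa> vs) = 2 ^ r * card (bit_span r vs \<inter> form_radical r \<kappa>)"
proof -
  note S = bit_subspace_span[OF vs(1)]
  have carr: "w \<in> carrier_vec r" if "w \<in> bit_span r vs" for w
    using bit_subspaceD(1)[OF S] that by auto
  have "bit_span r vs \<inter> form_radical r \<kappa> = {w \<in> bit_span r vs. \<forall>v\<in>carrier_vec r. form r \<kappa> v w = 0}"
    using carr by (auto simp: form_radical_def)
  moreover have "card (bit_span r vs) * card (form_perp r \<kappa> vs) = card (carrier_vec r :: bit vec set) *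
      card {w \<in> bit_span r vs. \<forall>v\<in>carrier_vec r. form r \<kappa> v w = 0}"
    unfolding form_perp_def
    by (rule card_annihilators[OF bit_subspace_carrier S])
      (auto intro!: form_add_left form_add_right dest: carr)
  ultimately show ?thesis
    by (simp add: card_bit_span[OF vs] card_carrier_vec_bit)
qed

lemma isotropic_lists_Suc:
  "isotropic_lists r \<kappa> (Suc k) =
    {v # vs | v vs. vs \<in> isotropic_lists r \<kappa> k \<and> v \<in> form_perp r \<kappa> vs - bit_span r vs}"
  by (auto simp: isotropic_lists_def indep_lists_def form_perp_def length_Suc_conv)

text \<open>The next vector is chosen in \<open>form_perp\<close> but outside the span. By isotropy
  the span lies in \<open>form_perp\<close>, so exactly its \<open>2 ^ k\<close> elements are
  removed.\<close>

lemma card_isotropic_lists_Suc: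
  assumes \<kappa>: "\<kappa> \<le> r"
  shows "real (card (isotropic_lists r \<kappa> (Suc k))) =
    (\<Sum>vs\<in>isotropic_lists r \<kappa> k. 2 ^ r / 2 ^ k * real (card (bit_span r vs \<inter> form_radical r \<kappa>)) - 2 ^ k)"
proof -
  have fin: "finite (form_perp r \<kappa> vs)" for vs
    by (simp add: form_perp_def finite_carrier_vec_bit)
  have "real (card (isotropic_lists r \<kappa> (Suc k))) =
      (\<Sum>vs\<in>isotropic_lists r \<kappa> k. \<Sum>v\<in>form_perp r \<kappa> vs - bit_span r vs. 1)"
    unfolding isotropic_lists_Suc real_of_card
    by (subst sum_Cons_image) (auto simp: fin)
  also have "\<dots> = (\<Sum>vs\<in>isotropic_lists r \<kappa> k.
      2 ^ r / 2 ^ k * real (card (bit_span r vs \<inter> form_radical r \<kappa>)) - 2 ^ k)"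
  proof (intro sum.cong refl)
    fix vs assume "vs \<in> isotropic_lists r \<kappa> k"
    then have vs: "set vs \<subseteq> carrier_vec r" "bit_indep r vs" "length vs = k" "isotropic r \<kappa> vs"
      by (auto simp: isotropic_lists_def indep_lists_def)
    note S = bit_subspaceD[OF bit_subspace_span[OF vs(1)]]
    have sub: "bit_span r vs \<subseteq> form_perp r \<kappa> vs"
      using isotropic_span[OF \<kappa> vs(4,1)] S(1) by (auto simp: form_perp_def)
    have "2 ^ k * real (card (form_perp r \<kappa> vs)) = 2 ^ r * real (card (bit_span r vs \<inter> form_radical r \<kappa>))"
      using arg_cong[OF card_form_perp[OF vs(1,2), of \<kappa>], of real] vs(3) by simp
    then have "real (card (form_perp r \<kappa> vs)) =
        2 ^ r / 2 ^ k * real (card (bit_span r vs \<inter> form_radical r \<kappa>))"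
      by (simp add: field_simps)
    then show "(\<Sum>v\<in>form_perp r \<kappa> vs - bit_span r vs. 1) =
        2 ^ r / 2 ^ k * real (card (bit_span r vs \<inter> form_radical r \<kappa>)) - 2 ^ k"
      using card_mono[OF fin sub] card_bit_span[OF vs(1,2)] vs(3) S(4) sub
      by (simp add: card_Diff_subset of_nat_diff)
  qed
  finally show ?thesis .
qed

lemma card_isotropic_lists_le: "card (isotropic_lists r \<kappa> k) \<le> 2 ^ (r * k)"
proof -
  have "isotropic_lists r \<kappa> k \<subseteq> vec_lists r k"
    by (auto simp: isotropic_lists_def indep_lists_def vec_lists_def)
  then show ?thesis
    using card_mono[OF finite_vec_lists] by (metis card_vec_lists)
qed

lemma corank_moment_0: "corank_moment r \<kappa> 0 = 1"
proof -
  have "isotropic_lists r \<kappa> 0 = {[]}"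
    by (auto simp: isotropic_lists_def indep_lists_def)
  then show ?thesis
    by (simp add: corank_moment_def binomial_eq_0)
qed

section \<open>Estimates for the moments\<close>

lemma corank_moment_nonneg: "corank_moment r \<kappa> k \<ge> 0"
  by (simp add: corank_moment_def)

text \<open>The crude bound by the number of all lists; it is the useful one when \<open>k\<close>
  is large compared with \<open>\<kappa>\<close>.\<close>

lemma corank_moment_le: "corank_moment r \<kappa> k \<le> 2 ^ (k choose 2)"
proof -
  have "real (card (isotropic_lists r \<kappa> k)) \<le> 2 ^ (r * k)"
    using card_isotropic_lists_le[of r \<kappa> k] by (metis of_nat_le_iff of_nat_numeral of_nat_power)
  then show ?thesis
    by (simp add: corank_moment_def field_simps)
qed

text \<open>The normalization absorbs the factor \<open>2 ^ r / 2 ^ k\<close>, leaving two errors of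
  opposite sign: the excess \<open>e\<close> caused by the radical and the removal of the span. They
  contribute 2 and 1 to the constant 3.\<close>

lemma corank_moment_Suc_diff:
  assumes \<kappa>: "\<kappa> \<le> r"
  shows "\<bar>corank_moment r \<kappa> (Suc k) - corank_moment r \<kappa> k\<bar> \<le> 3 * 2 ^ ((k choose 2) + 2 * k) / 2 ^ \<kappa>"
proof -
  let ?I = "isotropic_lists r \<kappa> k" and ?R = "form_radical r \<kappa>"
  define t :: real where "t = 2 ^ (k choose 2)"
  define n where "n = real (card ?I)"
  define e where "e = (\<Sum>vs\<in>?I. real (card (bit_span r vs \<inter> ?R)) - 1)"
  have one_le: "1 \<le> real (card (bit_span r vs \<inter> ?R))" if "vs \<in> vec_lists r k" for vs
  proof -
    have "0\<^sub>v r \<in> bit_span r vs \<inter> ?R"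
      using that bit_subspaceD(2)[OF bit_subspace_span[of vs r]] zero_mem_form_radical
      by (auto simp: vec_lists_def)
    moreover have "finite (bit_span r vs \<inter> ?R)"
      using finite_form_radical by blast
    ultimately have "card (bit_span r vs \<inter> ?R) > 0"
      by (auto simp: card_gt_0_iff)
    then show ?thesis
      by simp
  qed
  have sub: "?I \<subseteq> vec_lists r k"
    by (auto simp: isotropic_lists_def indep_lists_def vec_lists_def)
  have e0: "0 \<le> e"
    unfolding e_def using one_le sub by (intro sum_nonneg) auto
  \<comment> \<open>Every summand is nonnegative because the zero vector lies in both sets, so the
    sum may be extended to all lists, where \<open>sum_card_span_Int\<close> applies.\<close>
  have "e \<le> (\<Sum>vs\<in>vec_lists r k. real (card (bit_span r vs \<inter> ?R)) - 1)"
    unfolding e_def using one_le sub by (intro sum_mono2 finite_vec_lists) auto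
  also have "\<dots> = real (\<Sum>vs\<in>vec_lists r k. card (bit_span r vs \<inter> ?R)) - 2 ^ (r * k)"
    by (simp add: sum_subtractf card_vec_lists)
  finally have "2 ^ r * e \<le> 2 ^ r * real (\<Sum>vs\<in>vec_lists r k. card (bit_span r vs \<inter> ?R)) - 2 ^ r * 2 ^ (r * k)"
    by (metis mult_left_mono right_diff_distrib zero_le_numeral zero_le_power)
  moreover have "2 ^ r * real (\<Sum>vs\<in>vec_lists r k. card (bit_span r vs \<inter> ?R)) \<le>
      2 ^ (r * k) * (2 ^ r + 2 ^ k * real (card ?R))"
  proof -
    have "?R \<subseteq> carrier_vec r"
      by (auto simp: form_radical_def)
    from sum_card_span_Int[OF this, of k]
    have "real (2 ^ r * (\<Sum>vs\<in>vec_lists r k. card (bit_span r vs \<inter> ?R))) \<le>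
        real (2 ^ (r * k) * (2 ^ r + 2 ^ k * card ?R))"
      by (rule of_nat_mono)
    then show ?thesis
      by simp
  qed
  ultimately have "2 ^ r * e \<le> 2 ^ (r * k) * 2 ^ k * real (card ?R)"
    by (simp add: algebra_simps)
  also have "\<dots> \<le> 2 ^ (r * k) * 2 ^ k * (2 * 2 ^ (r - \<kappa>))"
    using of_nat_mono[OF card_form_radical[OF \<kappa>], where 'a = real] by (intro mult_left_mono) auto
  also have "(2 :: real) ^ (r - \<kappa>) = 2 ^ r / 2 ^ \<kappa>"
    using \<kappa> by (simp add: power_diff)
  finally have e1: "e / 2 ^ (r * k) \<le> 2 * 2 ^ k / 2 ^ \<kappa>"
    by (simp add: field_simps)
  have n1: "n / 2 ^ (r * k) \<le> 1"
    using of_nat_mono[OF card_isotropic_lists_le[of r \<kappa> k], where 'a = real] by (simp add: n_def)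
  have "real (card (isotropic_lists r \<kappa> (Suc k))) = 2 ^ r / 2 ^ k * (n + e) - 2 ^ k * n"
    unfolding card_isotropic_lists_Suc[OF \<kappa>]
    by (simp add: sum_subtractf e_def n_def sum_distrib_left sum_divide_distrib algebra_simps)
  then have "corank_moment r \<kappa> (Suc k) = (2 ^ r / 2 ^ k * (n + e) - 2 ^ k * n) * (2 ^ k * t) / (2 ^ r * 2 ^ (r * k))"
    by (simp add: corank_moment_def t_def Suc_choose_two power_add)
  also have "\<dots> = t * (n / 2 ^ (r * k)) + t * (e / 2 ^ (r * k)) - t * (2 ^ k * 2 ^ k) / 2 ^ r * (n / 2 ^ (r * k))"
    by (simp add: field_simps)
  finally have eq: "corank_moment r \<kappa> (Suc k) - corank_moment r \<kappa> k =
      t * (e / 2 ^ (r * k)) - t * (2 ^ k * 2 ^ k) / 2 ^ r * (n / 2 ^ (r * k))"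
    by (simp add: corank_moment_def t_def n_def)
  have t: "t > 0"
    by (simp add: t_def)
  have "0 \<le> t * (e / 2 ^ (r * k))"
    using t e0 by simp
  moreover have "t * (e / 2 ^ (r * k)) \<le> t * (2 * (2 ^ k * 2 ^ k) / 2 ^ \<kappa>)"
  proof -
    have "(1 :: real) * 2 ^ k \<le> 2 ^ k * 2 ^ k"
      by (intro mult_right_mono) auto
    then have "2 * 2 ^ k / 2 ^ \<kappa> \<le> 2 * (2 ^ k * 2 ^ k) / (2 ^ \<kappa> :: real)"
      by (intro divide_right_mono) auto
    then show ?thesis
      using e1 t by (intro mult_left_mono) auto
  qed
  moreover have "0 \<le> t * (2 ^ k * 2 ^ k) / 2 ^ r * (n / 2 ^ (r * k))"
    using t by (simp add: n_def)
  moreover have "t * (2 ^ k * 2 ^ k) / 2 ^ r * (n / 2 ^ (r * k)) \<le> t * (2 ^ k * 2 ^ k) / 2 ^ \<kappa> * 1"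
    using t \<kappa> n1 by (intro mult_mono divide_left_mono power_increasing) (auto simp: n_def)
  ultimately have "\<bar>corank_moment r \<kappa> (Suc k) - corank_moment r \<kappa> k\<bar> \<le>
      t * (2 * (2 ^ k * 2 ^ k) / 2 ^ \<kappa>) + t * (2 ^ k * 2 ^ k) / 2 ^ \<kappa>"
    unfolding eq by linarith
  also have "\<dots> = 3 * (t * (2 ^ k * 2 ^ k)) / 2 ^ \<kappa>"
    by (simp only: times_divide_eq_right mult.left_commute[of t 2] add_divide_distrib[symmetric])
      simp
  also have "t * (2 ^ k * 2 ^ k) = 2 ^ ((k choose 2) + 2 * k)"
    by (simp add: t_def power_add mult_2)
  finally show ?thesis .
qed

text \<open>Telescoping from the exact value 1 at \<open>k = 0\<close>; the increments grow so fast
  that \<open>1 + 2 ^ k \<le> 2 * 2 ^ k\<close> preserves the shape of the bound.\<close>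

lemma corank_moment_diff_1:
  assumes \<kappa>: "\<kappa> \<le> r"
  shows "\<bar>corank_moment r \<kappa> k - 1\<bar> \<le> 3 * 2 ^ ((k choose 2) + k) / 2 ^ \<kappa>"
proof (induction k)
  case 0
  then show ?case
    by (simp add: corank_moment_0)
next
  case (Suc k)
  define x :: real where "x = 2 ^ (k choose 2) * 2 ^ k"
  have "\<bar>corank_moment r \<kappa> (Suc k) - 1\<bar> \<le> 3 * x / 2 ^ \<kappa> + 3 * (x * 2 ^ k) / 2 ^ \<kappa>"
    using Suc corank_moment_Suc_diff[OF \<kappa>, of k]
    by (simp add: x_def power_add mult_2 mult.assoc)
  also have "\<dots> = 3 * (x * (1 + 2 ^ k)) / 2 ^ \<kappa>"
    by (simp add: field_simps)
  also have "\<dots> \<le> 3 * (x * (2 * 2 ^ k)) / 2 ^ \<kappa>"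
    by (intro divide_right_mono mult_left_mono) (auto simp: x_def)
  also have "\<dots> = 3 * 2 ^ ((Suc k choose 2) + Suc k) / 2 ^ \<kappa>"
    by (simp add: x_def power_add Suc_choose_two mult_ac)
  finally show ?case .
qed

section \<open>Inversion of the moments\<close>

abbreviation eta_fin :: "nat \<Rightarrow> real" where
  "eta_fin n \<equiv> eta (enat n) 2"

lemma eta_fin_0: "eta_fin 0 = 1"
  by (simp add: eta_def)

lemma eta_fin_Suc: "eta_fin (Suc n) = eta_fin n * (1 - 1 / 2 ^ Suc n)"
  by (simp add: eta_def)

lemma one_minus_half_power_pos: "1 - 1 / (2 :: real) ^ Suc n > 0"
proof -
  have "(2 :: real) ^ Suc n > 1"
    by (rule one_less_power) auto
  then show ?thesis
    by (simp del: power_Suc)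
qed

lemma eta_fin_ge: "eta_fin n \<ge> 1 / 4"
proof -
  \<comment> \<open>The extra term makes the bound inductive: with
    \<open>q = 1 / 2 ^ (n + 2)\<close> the next factor is \<open>1 - q\<close>, and
    \<open>q \<le> 1 / 4\<close> gives
    \<open>(1 / 4 + q) * (1 - q) \<ge> 1 / 4 + q / 2\<close>.\<close>
  have "eta_fin (Suc n) \<ge> 1 / 4 + 1 / 2 ^ (n + 2)" for n
  proof (induction n)
    case 0
    then show ?case
      by (simp add: eta_fin_Suc eta_fin_0)
  next
    case (Suc n)
    define q :: real where "q = 1 / 2 ^ (n + 2)"
    have "(2 :: real) ^ 2 \<le> 2 ^ (n + 2)"
      by (intro power_increasing) auto
    then have q: "0 < q" "q \<le> 1 / 4"
      unfolding q_def by (auto intro: divide_left_mono[of 4 _ 1, simplified])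
    have "1 / 4 + q \<le> eta_fin (Suc n)"
      using Suc by (simp add: q_def)
    have "q * q \<le> 1 / 4 * q"
      using q by (intro mult_right_mono) auto
    then have "1 / 4 + q / 2 \<le> 1 / 4 + 3 / 4 * q - q * q"
      by linarith
    also have "\<dots> = (1 / 4 + q) * (1 - q)"
      by (simp add: field_simps)
    finally have "1 / 4 + q / 2 \<le> (1 / 4 + q) * (1 - q)" .
    also have "(1 / 4 + q) * (1 - q) \<le> eta_fin (Suc n) * (1 - q)"
      using \<open>1 / 4 + q \<le> eta_fin (Suc n)\<close> q by (intro mult_right_mono) auto
    also have "\<dots> = eta_fin (Suc (Suc n))"
      by (subst eta_fin_Suc[of "Suc n"]) (simp add: q_def)
    finally show ?case
      by (simp add: q_def)
  qed
  from this[of "n - 1"] have "eta_fin (Suc (n - 1)) \<ge> 1 / 4"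
    by (rule order_trans[rotated]) simp
  then show ?thesis
    by (cases n) (auto simp: eta_fin_0)
qed

lemma eta_fin_pos: "eta_fin n > 0"
  using eta_fin_ge[of n] by simp

lemma eta_fin_tendsto: "eta_fin \<longlonglongrightarrow> eta \<infinity> 2"
proof -
  have "convergent_prod (\<lambda>j. 1 - 1 / 2 ^ Suc j :: real)"
    by (rule eta_infinity_convergent) simp
  then have "(\<lambda>n. \<Prod>j\<le>n. 1 - 1 / 2 ^ Suc j) \<longlonglongrightarrow> eta \<infinity> 2"
    unfolding eta_def by (simp add: convergent_prod_LIMSEQ)
  moreover have "(\<Prod>j\<le>n. 1 - 1 / 2 ^ Suc j) = eta_fin (Suc n)" for n
    by (induction n) (simp_all add: eta_fin_Suc eta_fin_0)
  ultimately show ?thesis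
    by (simp only: LIMSEQ_imp_Suc)
qed

section \<open>The \<open>q\<close>-binomial theorem at \<open>q = 1/2\<close>\<close>

lemma add_choose_two: "(i + j) choose 2 = (i choose 2) + (j choose 2) + i * j"
  by (induction i) (simp_all add: Suc_choose_two binomial_eq_0)

lemma choose_two_square: "2 * (j choose 2) + j = j ^ 2"
  by (induction j) (simp_all add: Suc_choose_two binomial_eq_0 power2_eq_square)

text \<open>The \<open>q\<close>-Pascal rule with the powers of 2 replaced by variables; it amounts
  to \<open>s * t - 1 = s * (t - 1) + (s - 1)\<close>.\<close>

lemma q_pascal_identity:
  fixes s t c e f :: real
  assumes "s > 1" "t > 1" "c > 0" "e > 0" "f > 0"
  shows "(1 - 1 / (s * t)) * (1 / (s * c * (e * (1 - 1 / s)) * (f * (1 - 1 / t)))) =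
    1 / (s * c * (e * (1 - 1 / s)) * f) + 1 / (s * t) * (1 / (c * e * (f * (1 - 1 / t))))"
proof -
  define u v where "u = s - 1" and "v = t - 1"
  have ne: "s \<noteq> 0" "t \<noteq> 0" "u \<noteq> 0" "v \<noteq> 0" "c \<noteq> 0" "e \<noteq> 0" "f \<noteq> 0"
    using assms by (auto simp: u_def v_def)
  have eqs: "1 - 1 / s = u / s" "1 - 1 / t = v / t" "1 - 1 / (s * t) = (s * v + u) / (s * t)"
    using ne by (simp_all add: u_def v_def diff_divide_distrib algebra_simps)
  have "(s * v + u) / (s * t) * (1 / (s * c * (e * (u / s)) * (f * (v / t)))) =
      (s * v + u) / (c * e * f * s * u * v)"
    using ne by simp
  also have "\<dots> = 1 / (s * c * (e * (u / s)) * f) + 1 / (s * t) * (1 / (c * e * (f * (v / t))))"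
    using ne by (simp add: add_divide_distrib mult_ac)
  finally show ?thesis
    unfolding eqs .
qed

text \<open>Gauss's formula divided by \<open>eta_fin N\<close>. The Pascal rule for the
  coefficients says that passing from \<open>N\<close> to \<open>Suc N\<close> multiplies the sum by
  \<open>(1 - q * x) / (1 - q)\<close>, as it does the right side.\<close>

lemma q_binomial_half:
  fixes x :: real
  shows "(\<Sum>i\<le>N. (- x) ^ i / (2 ^ (Suc i choose 2) * eta_fin i * eta_fin (N - i))) =
    (\<Prod>m=1..N. 1 - x / 2 ^ m) / eta_fin N"
proof (induction N)
  case 0
  then show ?case
    by (simp add: eta_fin_0 binomial_eq_0)
next
  case (Suc N)
  \<comment> \<open>Padding with 0 beyond \<open>N\<close> lets the Pascal rule hold for all
    \<open>i\<close>, including the boundary case \<open>i = Suc N\<close>.\<close>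
  define a where "a N i = (if i \<le> N then 1 / (2 ^ (Suc i choose 2) * eta_fin i * eta_fin (N - i)) else 0)"
    for N i :: nat
  define q :: real where "q = 1 / 2 ^ Suc N"
  have q: "1 - q \<noteq> 0"
    unfolding q_def using one_minus_half_power_pos[of N] by simp
  have G: "(\<Sum>i\<le>N. (- x) ^ i / (2 ^ (Suc i choose 2) * eta_fin i * eta_fin (N - i))) =
      (\<Sum>i\<le>N. a N i * (- x) ^ i)" for N
    by (intro sum.cong) (auto simp: a_def)
  have pascal: "(1 - q) * a (Suc N) i = a N i + q * (case i of 0 \<Rightarrow> 0 | Suc i' \<Rightarrow> a N i')" for i
  proof -
    consider "i = 0" | i' where "i = Suc i'" "i \<le> N" | "i = Suc N" | "i > Suc N"
      by (cases i; cases "i \<le> N"; cases "i = Suc N") auto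
    then show ?thesis
    proof cases
      case 1
      then show ?thesis
        using q eta_fin_pos[of N] by (simp add: a_def eta_fin_0 eta_fin_Suc q_def)
    next
      case (2 i')
      define l where "l = N - i"
      have N: "N = Suc i' + l"
        using 2 by (simp add: l_def)
      define c :: real where "c = 2 ^ (Suc i' choose 2)"
      define s t :: real where "s = 2 ^ Suc i'" and "t = 2 ^ Suc l"
      have st: "s > 1" "t > 1" "c > 0"
        using one_less_power[of "2 :: real" "Suc i'"] one_less_power[of "2 :: real" "Suc l"]
        by (simp_all add: s_def t_def c_def del: power_Suc)
      have qst: "q = 1 / (s * t)"
        by (simp add: q_def s_def t_def N power_add)
      have [simp]: "Suc N - i = Suc l" "N - i = l" "N - i' = Suc l" "i \<le> Suc N" "i \<le> N" "i' \<le> N"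
        using 2 N by auto
      have i: "(2 :: real) ^ (Suc i choose 2) = s * c" "eta_fin i = eta_fin i' * (1 - 1 / s)"
        "eta_fin (Suc l) = eta_fin l * (1 - 1 / t)"
        using 2 by (simp_all add: eta_fin_Suc s_def c_def t_def power_add Suc_choose_two[of "Suc i'"])
      have e: "eta_fin i' > 0" "eta_fin l > 0"
        by (rule eta_fin_pos)+
      have "(1 - q) * a (Suc N) i = (1 - 1 / (s * t)) *
          (1 / (s * c * (eta_fin i' * (1 - 1 / s)) * (eta_fin l * (1 - 1 / t))))"
        by (simp only: a_def if_True i qst \<open>Suc N - i = Suc l\<close> \<open>i \<le> Suc N\<close>)
      also have "\<dots> = 1 / (s * c * (eta_fin i' * (1 - 1 / s)) * eta_fin l) +
          1 / (s * t) * (1 / (c * eta_fin i' * (eta_fin l * (1 - 1 / t))))"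
        by (rule q_pascal_identity) (use st e in auto)
      also have "\<dots> = a N i + q * a N i'"
        by (simp only: a_def if_True i qst c_def[symmetric] \<open>N - i = l\<close> \<open>N - i' = Suc l\<close>
            \<open>i \<le> N\<close> \<open>i' \<le> N\<close>)
      finally show ?thesis
        using 2(1) by simp
    next
      case 3
      have e: "eta_fin (Suc N) = eta_fin N * (1 - q)"
        by (simp only: eta_fin_Suc q_def)
      have p: "(2 :: real) ^ (Suc (Suc N) choose 2) = 2 ^ (Suc N choose 2) / q"
        by (simp add: Suc_choose_two[of "Suc N"] power_add q_def)
      have "(1 - q) * a (Suc N) (Suc N) = q * a N N"
        using q by (simp add: a_def e p eta_fin_0)
      moreover have "a N (Suc N) = 0"
        by (simp add: a_def)
      ultimately show ?thesis
        using 3 by simp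
    next
      case 4
      then show ?thesis
        by (auto simp: a_def split: nat.split)
    qed
  qed
  have "(1 - q) * (\<Sum>i\<le>Suc N. a (Suc N) i * (- x) ^ i) =
      (\<Sum>i\<le>Suc N. ((1 - q) * a (Suc N) i) * (- x) ^ i)"
    by (simp only: sum_distrib_left mult.assoc)
  also have "\<dots> = (\<Sum>i\<le>Suc N. a N i * (- x) ^ i) +
      q * (\<Sum>i\<le>Suc N. (case i of 0 \<Rightarrow> 0 | Suc i' \<Rightarrow> a N i') * (- x) ^ i)"
    unfolding pascal by (simp only: sum_distrib_left distrib_right sum.distrib mult.assoc)
  also have "(\<Sum>i\<le>Suc N. a N i * (- x) ^ i) = (\<Sum>i\<le>N. a N i * (- x) ^ i)"
    by (simp add: a_def)
  also have "(\<Sum>i\<le>Suc N. (case i of 0 \<Rightarrow> 0 | Suc i' \<Rightarrow> a N i') * (- x) ^ i) =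
      - x * (\<Sum>i\<le>N. a N i * (- x) ^ i)"
    by (subst sum.atMost_Suc_shift) (simp add: sum_distrib_left mult_ac)
  also have "(\<Sum>i\<le>N. a N i * (- x) ^ i) + q * (- x * (\<Sum>i\<le>N. a N i * (- x) ^ i)) =
      (1 - q * x) * (\<Sum>i\<le>N. a N i * (- x) ^ i)"
    by (simp add: algebra_simps)
  also have "\<dots> = (1 - q * x) * ((\<Prod>m=1..N. 1 - x / 2 ^ m) / eta_fin N)"
    using Suc unfolding G by simp
  also have "\<dots> = (1 - q) * ((\<Prod>m=1..Suc N. 1 - x / 2 ^ m) / eta_fin (Suc N))"
    using q by (simp add: eta_fin_Suc q_def)
  finally show ?case
    unfolding G by (rule mult_left_cancel[OF q, THEN iffD1])
qed

section \<open>Recovering a distribution from its moments\<close>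

lemma prod_diff_powers:
  "k \<le> d \<Longrightarrow> (\<Prod>m<k. (2 :: real) ^ d - 2 ^ m) = 2 ^ (d * k) * eta_fin d / eta_fin (d - k)"
proof (induction k)
  case 0
  then show ?case
    using eta_fin_pos[of d] by simp
next
  case (Suc k)
  define l where "l = d - Suc k"
  have d: "d = k + Suc l" "d - k = Suc l" "d - Suc k = l"
    using Suc.prems by (auto simp: l_def)
  have *: "(2 :: real) ^ d - 2 ^ k = 2 ^ d * (1 - 1 / 2 ^ Suc l)"
    unfolding d(1) by (simp add: power_add field_simps)
  have "1 - 1 / (2 :: real) ^ Suc l \<noteq> 0"
    using one_minus_half_power_pos[of l] by simp
  then have "(\<Prod>m<Suc k. (2 :: real) ^ d - 2 ^ m) = 2 ^ (d * k) * eta_fin d / eta_fin l * 2 ^ d"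
    using Suc d(2) unfolding prod.lessThan_Suc *
    by (simp add: eta_fin_Suc)
  then show ?case
    by (simp add: d(3) power_add)
qed

lemma prod_diff_powers_eq_0:
  "d < k \<Longrightarrow> (\<Prod>m<k. (2 :: real) ^ d - 2 ^ m) = 0"
  by (rule prod_zero) auto

text \<open>The weight with which the moment of order \<open>j + i\<close> enters the probability of
  the value \<open>j\<close>.\<close>

definition inversion_coeff :: "nat \<Rightarrow> nat \<Rightarrow> real" where
  "inversion_coeff j i =
    (- 1) ^ i / (eta_fin j * eta_fin i * 2 ^ (((i + j) choose 2) + (j choose 2) + (i + j)))"

text \<open>Each of the two \<open>eta_fin\<close> factors is at least \<open>1 / 4\<close>, whence
  16.\<close>

lemma inversion_coeff_bound:
  "\<bar>inversion_coeff j i\<bar> \<le> 16 / 2 ^ (((i + j) choose 2) + (j choose 2) + (i + j))"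
proof -
  have "1 / 4 * (1 / 4) \<le> eta_fin j * eta_fin i"
    using eta_fin_ge eta_fin_pos[of j] by (intro mult_mono) auto
  then have "1 / (eta_fin j * eta_fin i) \<le> 16"
    using eta_fin_pos[of j] eta_fin_pos[of i] by (simp add: field_simps)
  then have "1 / (eta_fin j * eta_fin i) / 2 ^ (((i + j) choose 2) + (j choose 2) + (i + j)) \<le>
      16 / 2 ^ (((i + j) choose 2) + (j choose 2) + (i + j))"
    by (intro divide_right_mono) auto
  then show ?thesis
    using eta_fin_pos[of j] eta_fin_pos[of i] by (simp add: inversion_coeff_def abs_mult power_abs)
qed

text \<open>Products of order above \<open>d\<close> vanish. With \<open>N = d - j\<close> the rest
  is the \<open>q\<close>-binomial sum at \<open>x = 2 ^ N\<close>, whose product has a zero factor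
  at \<open>m = N\<close> unless \<open>N = 0\<close>.\<close>

lemma moment_inversion:
  assumes "d \<le> n"
  shows "(\<Sum>i\<le>n. inversion_coeff j i * (\<Prod>m<j + i. 2 ^ d - 2 ^ m)) = of_bool (d = j)"
proof (cases "d < j")
  case True
  then show ?thesis
    by (simp add: prod_diff_powers_eq_0)
next
  case False
  define N where "N = d - j"
  have d: "d = j + N"
    using False by (simp add: N_def)
  have "(\<Sum>i\<le>n. inversion_coeff j i * (\<Prod>m<j + i. 2 ^ d - 2 ^ m)) =
      (\<Sum>i\<le>N. inversion_coeff j i * (\<Prod>m<j + i. 2 ^ d - 2 ^ m))"
    using assms d by (intro sum.mono_neutral_right) (auto simp: prod_diff_powers_eq_0)
  also have "\<dots> = (\<Sum>i\<le>N. 2 ^ (N * j) * eta_fin d / eta_fin j *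
      ((- (2 ^ N)) ^ i / (2 ^ (Suc i choose 2) * eta_fin i * eta_fin (N - i))))"
  proof (intro sum.cong refl)
    fix i assume i: "i \<in> {..N}"
    \<comment> \<open>This balance explains the exponent in \<open>inversion_coeff\<close>: the
      powers of 2 depending on \<open>i\<close> reduce to
      \<open>(2 ^ N) ^ i / 2 ^ (Suc i choose 2)\<close>.\<close>
    have "d * (j + i) + (Suc i choose 2) = N * j + N * i + (((i + j) choose 2) + (j choose 2) + (i + j))"
      using choose_two_square[of j]
      by (simp add: d add_choose_two Suc_choose_two power2_eq_square algebra_simps)
    then have "(2 :: real) ^ (d * (j + i)) * 2 ^ (Suc i choose 2) =
        2 ^ (N * j) * 2 ^ (N * i) * 2 ^ (((i + j) choose 2) + (j choose 2) + (i + j))"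
      by (metis power_add)
    then have "(2 :: real) ^ (d * (j + i)) / 2 ^ (((i + j) choose 2) + (j choose 2) + (i + j)) =
        2 ^ (N * j) * 2 ^ (N * i) / 2 ^ (Suc i choose 2)"
      by (simp add: frac_eq_eq)
    moreover have "inversion_coeff j i * (\<Prod>m<j + i. 2 ^ d - 2 ^ m) =
        (- 1) ^ i * (2 ^ (d * (j + i)) / 2 ^ (((i + j) choose 2) + (j choose 2) + (i + j))) *
        (eta_fin d / (eta_fin j * eta_fin i * eta_fin (N - i)))"
      using i d by (simp add: inversion_coeff_def prod_diff_powers mult_ac)
    moreover have "(- (2 ^ N)) ^ i = (- 1) ^ i * (2 :: real) ^ (N * i)"
      by (subst power_minus) (simp add: power_mult)
    ultimately show "inversion_coeff j i * (\<Prod>m<j + i. 2 ^ d - 2 ^ m) =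
        2 ^ (N * j) * eta_fin d / eta_fin j *
        ((- (2 ^ N)) ^ i / (2 ^ (Suc i choose 2) * eta_fin i * eta_fin (N - i)))"
      by (simp add: mult_ac)
  qed
  also have "\<dots> = 2 ^ (N * j) * eta_fin d / eta_fin j * ((\<Prod>m=1..N. 1 - 2 ^ N / 2 ^ m) / eta_fin N)"
    unfolding sum_distrib_left[symmetric] q_binomial_half ..
  also have "\<dots> = of_bool (d = j)"
  proof (cases N)
    case 0
    then show ?thesis
      using eta_fin_pos[of j] by (simp add: d eta_fin_0)
  next
    case (Suc N')
    then have "(\<Prod>m=1..N. 1 - 2 ^ N / 2 ^ m) = (0 :: real)"
      by (intro prod_zero) (auto intro!: bexI[of _ N])
    then show ?thesis
      using Suc d by simp
  qed
  finally show ?thesis .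
qed

section \<open>The Cohen-Lenstra law from constant moments 1\<close>

text \<open>Euler's product expansion at \<open>q = 1/2\<close>: the power series \<open>F\<close> satisfies
  \<open>F x = (1 - x / 2) * F (x / 2)\<close>.\<close>

lemma euler_half_sums:
  "(\<lambda>i. (- 1) ^ i / (2 ^ (Suc i choose 2) * eta_fin i) * (1 / 2 ^ j) ^ i) sums (eta \<infinity> 2 / eta_fin j)"
proof -
  define f :: "nat \<Rightarrow> real" where "f i = (- 1) ^ i / (2 ^ (Suc i choose 2) * eta_fin i)" for i
  define F where "F x = (\<Sum>i. f i * x ^ i)" for x
  have f_bound: "\<bar>f i\<bar> \<le> 4 * (1 / 2) ^ i" for i
  proof -
    have "(2 :: real) ^ i * (1 / 4) \<le> 2 ^ (Suc i choose 2) * eta_fin i"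
      using eta_fin_ge by (intro mult_mono power_increasing) (auto simp: Suc_choose_two)
    then have "1 / (2 ^ (Suc i choose 2) * eta_fin i) \<le> 1 / (2 ^ i * (1 / 4))"
      by (intro divide_left_mono) (auto simp: eta_fin_pos)
    then show ?thesis
      using eta_fin_pos[of i] by (simp add: f_def abs_mult power_abs power_one_over)
  qed
  have summ: "summable (\<lambda>i. f i * x ^ i)" if "\<bar>x\<bar> \<le> 1" for x
  proof (rule summable_comparison_test')
    show "summable (\<lambda>i. 4 * (1 / 2 :: real) ^ i)"
      by (intro summable_mult summable_geometric) auto
    fix i :: nat
    have "\<bar>f i\<bar> * \<bar>x\<bar> ^ i \<le> 4 * (1 / 2) ^ i * 1"
      using that by (intro mult_mono f_bound power_le_one) auto
    then show "norm (f i * x ^ i) \<le> 4 * (1 / 2) ^ i"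
      by (simp add: abs_mult power_abs)
  qed
  have f_Suc: "f (Suc i) * (1 - 1 / 2 ^ Suc i) = - f i / 2 ^ Suc i" for i
  proof -
    have "1 - 1 / (2 :: real) ^ Suc i \<noteq> 0"
      using one_minus_half_power_pos[of i] by simp
    then show ?thesis
      by (simp add: f_def eta_fin_Suc Suc_choose_two[of "Suc i"] power_add del: power_Suc)
  qed
  have step: "F x = (1 - x / 2) * F (x / 2)" if x: "\<bar>x\<bar> \<le> 1" for x
  proof -
    have x2: "\<bar>x / 2\<bar> \<le> 1"
      using x by simp
    note S = summ[OF x2]
    have "F x - F (x / 2) = (\<Sum>i. f i * x ^ i - f i * (x / 2) ^ i)"
      unfolding F_def using summ[OF x] S by (rule suminf_diff)
    also have "\<dots> = (\<Sum>i. f (Suc i) * x ^ Suc i - f (Suc i) * (x / 2) ^ Suc i)"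
      by (subst suminf_split_head) (use summable_diff[OF summ[OF x] S] in auto)
    also have "(\<lambda>i. f (Suc i) * x ^ Suc i - f (Suc i) * (x / 2) ^ Suc i) =
        (\<lambda>i. - (x / 2) * (f i * (x / 2) ^ i))"
    proof
      fix i
      have "f (Suc i) * x ^ Suc i - f (Suc i) * (x / 2) ^ Suc i = f (Suc i) * (1 - 1 / 2 ^ Suc i) * x ^ Suc i"
        by (simp add: power_divide algebra_simps)
      also have "\<dots> = - (x / 2) * (f i * (x / 2) ^ i)"
        unfolding f_Suc by (simp add: power_divide)
      finally show "f (Suc i) * x ^ Suc i - f (Suc i) * (x / 2) ^ Suc i = - (x / 2) * (f i * (x / 2) ^ i)" .
    qed
    also have "(\<Sum>i. - (x / 2) * (f i * (x / 2) ^ i)) = - (x / 2) * F (x / 2)"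
      unfolding F_def by (rule suminf_mult[OF S])
    finally show ?thesis
      by (simp add: algebra_simps)
  qed
  \<comment> \<open>Iteration drives the argument to 0, where \<open>F\<close> is continuous with
    value 1, while the accumulated factors tend to
    \<open>eta \<infinity> 2 / eta_fin j\<close>.\<close>
  have iter: "F (1 / 2 ^ j) = eta_fin (j + n) / eta_fin j * F (1 / 2 ^ (j + n))" for n
  proof (induction n)
    case 0
    then show ?case
      using eta_fin_pos[of j] by simp
  next
    case (Suc n)
    have "F (1 / 2 ^ (j + n)) = (1 - 1 / 2 ^ Suc (j + n)) * F (1 / 2 ^ Suc (j + n))"
      using step[of "1 / 2 ^ (j + n)"] by (simp add: mult.commute)
    then show ?case
      using Suc by (simp add: eta_fin_Suc)
  qed
  have "isCont F 0"
    unfolding F_def using summ[of 1] by (intro isCont_powser[of f 1]) auto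
  moreover have "(\<lambda>n. 1 / 2 ^ (j + n) :: real) \<longlonglongrightarrow> 0"
  proof -
    have "(\<lambda>n. (1 / 2 :: real) ^ n) \<longlonglongrightarrow> 0"
      by (rule LIMSEQ_power_zero) simp
    from LIMSEQ_ignore_initial_segment[OF this, of j] show ?thesis
      by (simp add: power_one_over add.commute)
  qed
  ultimately have "(\<lambda>n. F (1 / 2 ^ (j + n))) \<longlonglongrightarrow> F 0"
    by (rule isCont_tendsto_compose)
  moreover have "F 0 = 1"
    unfolding F_def by (subst powser_zero) (simp add: f_def eta_fin_0 binomial_eq_0)
  moreover have "(\<lambda>n. eta_fin (j + n)) \<longlonglongrightarrow> eta \<infinity> 2"
    using LIMSEQ_ignore_initial_segment[OF eta_fin_tendsto, of j] by (simp add: add.commute)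
  ultimately have "(\<lambda>n. eta_fin (j + n) / eta_fin j * F (1 / 2 ^ (j + n))) \<longlonglongrightarrow> eta \<infinity> 2 / eta_fin j * 1"
    using eta_fin_pos[of j] by (intro tendsto_intros) auto
  then have "F (1 / 2 ^ j) = eta \<infinity> 2 / eta_fin j"
    unfolding iter[symmetric] by (simp add: LIMSEQ_const_iff)
  moreover have "(\<lambda>i. f i * (1 / 2 ^ j) ^ i) sums F (1 / 2 ^ j)"
    unfolding F_def by (intro summable_sums summ) simp
  ultimately show ?thesis
    by (simp add: f_def)
qed

text \<open>Inversion applied to moments all equal to 1. Extracting
  \<open>1 / (2 ^ (j\<^sup>2) * eta_fin j)\<close> leaves Euler's series at
  \<open>1 / 2 ^ j\<close>.\<close>

lemma inversion_coeff_sums: "inversion_coeff j sums pi_CL j"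
proof -
  have eq: "inversion_coeff j = (\<lambda>i. 1 / (2 ^ (j\<^sup>2) * eta_fin j) *
      ((- 1) ^ i / (2 ^ (Suc i choose 2) * eta_fin i) * (1 / 2 ^ j) ^ i))"
  proof
    fix i
    have "((i + j) choose 2) + (j choose 2) + (i + j) = j\<^sup>2 + (Suc i choose 2) + j * i"
      using choose_two_square[of j] by (simp add: add_choose_two Suc_choose_two)
    then show "inversion_coeff j i = 1 / (2 ^ (j\<^sup>2) * eta_fin j) *
      ((- 1) ^ i / (2 ^ (Suc i choose 2) * eta_fin i) * (1 / 2 ^ j) ^ i)"
      by (simp add: inversion_coeff_def power_add power_mult power_one_over)
  qed
  have "pi_CL j = 1 / (2 ^ (j\<^sup>2) * eta_fin j) * (eta \<infinity> 2 / eta_fin j)"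
    by (simp add: pi_CL_def power2_eq_square)
  then show ?thesis
    unfolding eq by (simp only: sums_mult euler_half_sums)
qed

section \<open>Convergence of the distributions\<close>

lemma kernel_dim_le:
  fixes A :: "bit mat"
  assumes "A \<in> carrier_mat r r"
  shows "kernel_dim A \<le> r"
proof -
  have "(2 :: nat) ^ kernel_dim A \<le> 2 ^ r"
    using card_mono[OF finite_carrier_vec_bit mat_kernel_carrier[OF assms]]
    by (simp add: card_mat_kernel_bit[OF assms] card_carrier_vec_bit)
  then show ?thesis
    by (simp add: power_increasing_iff)
qed

text \<open>\<open>moment_inversion\<close> averaged over the matrices. Moments of order above
  \<open>r\<close> vanish, since the corank is at most \<open>r\<close>; the series form allows
  termwise comparison with \<open>inversion_coeff_sums\<close>.\<close>

lemma redei_corank_pmf_sums: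
  assumes \<kappa>: "\<kappa> \<le> r"
  shows "(\<lambda>i. inversion_coeff j i * corank_moment r \<kappa> (j + i)) sums pmf (redei_corank_pmf r \<kappa>) j"
proof -
  let ?R = "redei_matrices r \<kappa>"
  have fin: "finite ?R" and ne: "?R \<noteq> {}"
    using finite_redei_matrices redei_matrices_nonempty[OF \<kappa>] by auto
  then have R: "real (card ?R) > 0"
    by (simp add: card_gt_0_iff)
  have d: "kernel_dim A \<le> r" if "A \<in> ?R" for A
    by (rule kernel_dim_le[OF redei_carrier[OF that]])
  have zero: "corank_moment r \<kappa> k = 0" if k: "r < k" for k
  proof -
    have "(\<Sum>A\<in>?R. \<Prod>m<k. (2 :: real) ^ kernel_dim A - 2 ^ m) = 0"
      using d k by (intro sum.neutral ballI prod_diff_powers_eq_0) (meson le_less_trans)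
    then show ?thesis
      using sum_card_indep_lists_kernel[OF \<kappa>, of k] R by simp
  qed
  have "real (card ?R) * (\<Sum>i\<le>r. inversion_coeff j i * corank_moment r \<kappa> (j + i)) =
      (\<Sum>i\<le>r. inversion_coeff j i * (\<Sum>A\<in>?R. \<Prod>m<j + i. 2 ^ kernel_dim A - 2 ^ m))"
    unfolding sum_card_indep_lists_kernel[OF \<kappa>] by (simp add: sum_distrib_left mult_ac)
  also have "\<dots> = (\<Sum>A\<in>?R. \<Sum>i\<le>r. inversion_coeff j i * (\<Prod>m<j + i. 2 ^ kernel_dim A - 2 ^ m))"
    unfolding sum_distrib_left by (rule sum.swap)
  also have "\<dots> = (\<Sum>A\<in>?R. of_bool (kernel_dim A = j))"
    by (intro sum.cong refl moment_inversion d)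
  also have "\<dots> = real (card (?R \<inter> kernel_dim -` {j}))"
    using fin by (simp add: sum_of_bool_eq Int_def)
  finally have "(\<Sum>i\<le>r. inversion_coeff j i * corank_moment r \<kappa> (j + i)) =
      real (card (?R \<inter> kernel_dim -` {j})) / real (card ?R)"
    using R by (simp add: field_simps)
  also have "\<dots> = pmf (redei_corank_pmf r \<kappa>) j"
    unfolding redei_corank_pmf_def pmf_map by (simp add: measure_pmf_of_set[OF ne fin])
  finally have sum: "(\<Sum>i\<le>r. inversion_coeff j i * corank_moment r \<kappa> (j + i)) = pmf (redei_corank_pmf r \<kappa>) j" .
  have "(\<lambda>i. inversion_coeff j i * corank_moment r \<kappa> (j + i)) sums
      (\<Sum>i\<le>r. inversion_coeff j i * corank_moment r \<kappa> (j + i))"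
    by (intro sums_finite) (auto simp: zero)
  then show ?thesis
    unfolding sum .
qed

text \<open>The error of the moment of order \<open>k = i + j\<close> is at most \<open>3 * 2 ^ ((k choose 2) + k) / 2 ^ \<kappa>\<close>, which
  is good for small \<open>k\<close> only, and at most \<open>2 ^ (k choose 2)\<close>. Taking the geometric mean of the two
  gives decay both in \<open>\<kappa>\<close> and in \<open>i\<close>.\<close>

lemma inversion_term_bound:
  assumes \<kappa>: "\<kappa> \<le> r"
  defines "s \<equiv> sqrt (1 / 2)"
  shows "\<bar>inversion_coeff j i * (corank_moment r \<kappa> (j + i) - 1)\<bar> \<le> 64 * (1 / 2) ^ j * s ^ \<kappa> * s ^ i"
proof -
  define k where "k = i + j"
  define y where "y = \<bar>corank_moment r \<kappa> k - 1\<bar> / 2 ^ ((k choose 2) + k)"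
  have s: "0 \<le> s" "s \<le> 1" "s\<^sup>2 = 1 / 2"
    by (simp_all add: s_def)
  have y0: "y \<ge> 0"
    by (simp add: y_def)
  have y1: "y \<le> 3 / 2 ^ \<kappa>"
    using corank_moment_diff_1[OF \<kappa>, of k] by (simp add: y_def field_simps)
  have "\<bar>corank_moment r \<kappa> k - 1\<bar> \<le> 2 ^ (k choose 2)"
    using corank_moment_nonneg[of r \<kappa> k] corank_moment_le[of r \<kappa> k] one_le_power[of "2 :: real" "k choose 2"]
    by linarith
  then have y2: "y \<le> 1 / 2 ^ k"
    by (simp add: y_def power_add field_simps)
  have "y\<^sup>2 \<le> 3 / 2 ^ \<kappa> * (1 / 2 ^ k)"
    unfolding power2_eq_square using y0 y1 y2 by (intro mult_mono) auto
  \<comment> \<open>The constant 3 is enlarged to 4 to obtain a perfect square.\<close>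
  also have "\<dots> \<le> 4 * (1 / 2) ^ \<kappa> * (1 / 2) ^ k"
    by (simp add: power_one_over field_simps)
  also have "\<dots> = (2 * s ^ \<kappa> * s ^ k)\<^sup>2"
    unfolding s(3)[symmetric] by (simp add: power_mult_distrib power_mult[symmetric] mult.commute)
  finally have "y \<le> 2 * s ^ \<kappa> * s ^ k"
    by (rule power2_le_imp_le) (use s in auto)
  also have "s ^ k \<le> s ^ i"
    using s by (intro power_decreasing) (auto simp: k_def)
  finally have y: "y \<le> 2 * s ^ \<kappa> * s ^ i"
    using s by (simp add: mult_left_mono)
  \<comment> \<open>This turns \<open>1 / 2 ^ (j choose 2)\<close> into geometric decay in
    \<open>j\<close>, as needed for the sum over \<open>j\<close>.\<close>
  have "j \<le> Suc (j choose 2)"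
    by (induction j) (auto simp: Suc_choose_two)
  then have "(2 :: real) ^ j \<le> 2 ^ Suc (j choose 2)"
    by (intro power_increasing) auto
  then have j: "1 / 2 ^ (j choose 2) \<le> 2 * (1 / 2 :: real) ^ j"
    by (simp add: power_one_over field_simps)
  have "\<bar>inversion_coeff j i * (corank_moment r \<kappa> (j + i) - 1)\<bar> \<le>
      16 / 2 ^ ((k choose 2) + (j choose 2) + k) * \<bar>corank_moment r \<kappa> k - 1\<bar>"
    unfolding abs_mult k_def add.commute[of j i]
    by (intro mult_right_mono inversion_coeff_bound) auto
  also have "\<dots> = 16 * (1 / 2 ^ (j choose 2)) * y"
    by (simp add: y_def power_add)
  also have "\<dots> \<le> 16 * (2 * (1 / 2) ^ j) * (2 * s ^ \<kappa> * s ^ i)"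
    using j y y0 by (intro mult_mono) auto
  finally show ?thesis
    by simp
qed

text \<open>Subtracting the two inversion series leaves moment errors only; the geometric series in
  \<open>s ^ i\<close> yields \<open>1 / (1 - s)\<close>.\<close>

lemma redei_corank_pmf_dist:
  assumes \<kappa>: "\<kappa> \<le> r"
  defines "s \<equiv> sqrt (1 / 2)"
  shows "\<bar>pmf (redei_corank_pmf r \<kappa>) j - pi_CL j\<bar> \<le> 64 / (1 - s) * (1 / 2) ^ j * s ^ \<kappa>"
proof -
  have s: "0 \<le> s" "s < 1"
    by (simp_all add: s_def)
  have geo: "(\<lambda>i. 64 * (1 / 2) ^ j * s ^ \<kappa> * s ^ i) sums (64 * (1 / 2) ^ j * s ^ \<kappa> * (1 / (1 - s)))"
    using s by (intro sums_mult geometric_sums) auto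
  have "(\<lambda>i. inversion_coeff j i * (corank_moment r \<kappa> (j + i) - 1)) sums
      (pmf (redei_corank_pmf r \<kappa>) j - pi_CL j)"
    using sums_diff[OF redei_corank_pmf_sums[OF \<kappa>, of j] inversion_coeff_sums[of j]]
    by (simp add: right_diff_distrib)
  then have "\<bar>pmf (redei_corank_pmf r \<kappa>) j - pi_CL j\<bar> \<le> 64 * (1 / 2) ^ j * s ^ \<kappa> * (1 / (1 - s))"
    using inversion_term_bound[OF \<kappa>, of j] geo norm_suminf_le[of _ "\<lambda>i. 64 * (1 / 2) ^ j * s ^ \<kappa> * s ^ i"]
    by (metis (no_types, lifting) real_norm_def s_def sums_iff)
  then show ?thesis
    by (simp add: mult_ac)
qed

text \<open>The binomial weights have total 1, so the distance is at most the weighted mean of the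
  distances for fixed \<open>\<kappa>\<close>; averaging \<open>s ^ \<kappa>\<close> gives
  \<open>((1 + s) / 2) ^ r\<close> by the binomial theorem.\<close>

lemma mu_redei_dist:
  defines "s \<equiv> sqrt (1 / 2)"
  shows "\<bar>mu_redei r j - pi_CL j\<bar> \<le> 64 / (1 - s) * ((1 + s) / 2) ^ r * (1 / 2) ^ j"
proof -
  define D where "D = 64 / (1 - s) * (1 / 2) ^ j"
  have "(\<Sum>\<kappa>=0..r. real (r choose \<kappa>)) = 2 ^ r"
    using choose_row_sum[of r] by (simp add: atLeast0AtMost flip: of_nat_sum)
  then have "mu_redei r j - pi_CL j = 1 / 2 ^ r * (\<Sum>\<kappa>=0..r. real (r choose \<kappa>) * pmf (redei_corank_pmf r \<kappa>) j) -
      1 / 2 ^ r * (\<Sum>\<kappa>=0..r. real (r choose \<kappa>)) * pi_CL j"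
    by (simp add: mu_redei_def)
  also have "\<dots> = 1 / 2 ^ r *
      (\<Sum>\<kappa>=0..r. real (r choose \<kappa>) * (pmf (redei_corank_pmf r \<kappa>) j - pi_CL j))"
    by (simp only: right_diff_distrib sum_subtractf sum_distrib_right mult.assoc)
  finally have "\<bar>mu_redei r j - pi_CL j\<bar> = 1 / 2 ^ r *
      \<bar>\<Sum>\<kappa>=0..r. real (r choose \<kappa>) * (pmf (redei_corank_pmf r \<kappa>) j - pi_CL j)\<bar>"
    by (simp add: abs_mult)
  also have "\<dots> \<le> 1 / 2 ^ r *
      (\<Sum>\<kappa>=0..r. \<bar>real (r choose \<kappa>) * (pmf (redei_corank_pmf r \<kappa>) j - pi_CL j)\<bar>)"
    by (intro mult_left_mono sum_abs) auto
  also have "\<dots> \<le> 1 / 2 ^ r * (\<Sum>\<kappa>=0..r. real (r choose \<kappa>) * (D * s ^ \<kappa>))"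
    unfolding abs_mult D_def s_def
    by (intro mult_left_mono sum_mono mult_mono redei_corank_pmf_dist) auto
  also have "\<dots> = D * (1 / 2 ^ r * (\<Sum>\<kappa>\<le>r. real (r choose \<kappa>) * s ^ \<kappa> * 1 ^ (r - \<kappa>)))"
    by (simp add: atLeast0AtMost sum_distrib_left mult_ac)
  also have "(\<Sum>\<kappa>\<le>r. real (r choose \<kappa>) * s ^ \<kappa> * 1 ^ (r - \<kappa>)) = (s + 1) ^ r"
    by (rule binomial_ring[symmetric])
  finally show ?thesis
    by (simp add: D_def power_divide add.commute mult_ac)
qed

theorem theorem1p1:
  shows "\<exists>C \<rho> :: real. C > 0 \<and> 0 < \<rho> \<and> \<rho> < 1 \<and>
    (\<forall>r :: nat. l1_norm (\<lambda>j. mu_redei r j - pi_CL j) \<le> ennreal (C * \<rho> ^ r))"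
proof -
  define s :: real where "s = sqrt (1 / 2)"
  define \<rho> where "\<rho> = (1 + s) / 2"
  define D where "D = 64 / (1 - s)"
  have s: "0 < s" "s < 1"
    by (simp_all add: s_def)
  have D: "D > 0" and \<rho>: "0 < \<rho>" "\<rho> < 1"
    using s by (simp_all add: D_def \<rho>_def)
  have "l1_norm (\<lambda>j. mu_redei r j - pi_CL j) \<le> ennreal (2 * D * \<rho> ^ r)" for r
  proof -
    \<comment> \<open>Summation over \<open>j\<close> costs a factor \<open>1 / (1 - 1 / 2)\<close>,
      hence the constant \<open>2 * D\<close>.\<close>
    have geo: "(\<lambda>j. D * \<rho> ^ r * (1 / 2) ^ j) sums (D * \<rho> ^ r * (1 / (1 - 1 / 2)))"
      by (intro sums_mult geometric_sums) auto
    have "l1_norm (\<lambda>j. mu_redei r j - pi_CL j) \<le> (\<Sum>j. ennreal (D * \<rho> ^ r * (1 / 2) ^ j))"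
      unfolding l1_norm_def D_def \<rho>_def s_def
      by (intro suminf_le ennreal_leI mu_redei_dist) auto
    also have "\<dots> = ennreal (\<Sum>j. D * \<rho> ^ r * (1 / 2) ^ j)"
      using D \<rho> geo by (intro suminf_ennreal2) (auto simp: sums_iff)
    also have "(\<Sum>j. D * \<rho> ^ r * (1 / 2) ^ j) = 2 * D * \<rho> ^ r"
      using geo by (simp add: sums_iff)
    finally show ?thesis .
  qed
  then show ?thesis
    using D \<rho> by (intro exI[of _ "2 * D"] exI[of _ \<rho>]) auto
qed

end
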